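(* Let $F$ be a tract endowed with an involution, let $M$ be a matroid on a finite set $E$, let $\mathcal C$ be an $F$-signature of $M$ and let $\mathcal D$ be an $F$-signature of the dual matroid $M^*$. Then $\mathcal C$ and $\mathcal D$ are respectively the set of $F$-circuits and the set of $F$-cocircuits of a weak $F$-matroid with underlying matroid $M$ if and only if $X\perp Y$ for every $X\in\mathcal C$ and $Y\in\mathcal D$ with $|\underline X\cap\underline Y|\le 3$.
   Context: A tract $F=(G,N_G)$: an abelian group $G$ (multiplicative) with $N_G\subseteq\mathbb N[G]$ satisfying (T0) $0\in N_G$; (T1) $1\notin N_G$; (T2) a unique $\epsilon\in G$ has $1+\epsilon\in N_G$; (T3) $GN_G\subseteq N_G$. $F=G\cup\{0\}$, $F^\times=G$, $-x=\epsilon x$; sums of elements of $F$ are taken in $\mathbb N[G]$ omitting zeros. An involution is a tract homomorphism $x\mapsto\overline x$ of $F$ to itself with square the identity. For $X,Y\in F^E$, $X\perp Y$ means $\sum_eX(e)\overline{Y(e)}\in N_G$. Support: $\underline X=\{e:X(e)\ne0\}$. An $F$-signature of a matroid $M$ on $E$ is a set $\mathcal C\subseteq F^E$ with $0\notin\mathcal C$, $F^\times\mathcal C\subseteq\mathcal C$, such that taking supports induces a bijection from the scalar classes of $\mathcal C$ onto the circuits of $M$. A weak $F$-matroid on $E$ is a set $\mathcal C\subseteq F^E$ (its $F$-circuits) satisfying (C0) $0\notin\mathcal C$; (C1) $F^\times\mathcal C\subseteq\mathcal C$; (C2) if $\underline X\subseteq\underline Y$ for $X,Y\in\mathcal C$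 then $X=\alpha Y$ for some $\alpha\in F^\times$; (C3)' if $X,Y\in\mathcal C$ form a modular pair ($\underline X\ne\underline Y$ and $\underline X\cup\underline Y$ does not properly contain a union of two distinct supports of elements of $\mathcal C$) and $X(e)=-Y(e)\ne0$, then there is $Z\in\mathcal C$ with $Z(e)=0$ and $X(f)+Y(f)-Z(f)\in N_G$ for all $f$. Its underlying matroid has the supports of the $F$-circuits as circuits. Its $F$-cocircuits are the $F$-circuits of its dual weak $F$-matroid, namely the elements of $\mathcal C^\perp\setminus\{0\}$ of minimal support.
   Formalization: The F-cocircuits are the nonzero vectors of minimal support orthogonal to every F-circuit whose support meets theirs in at most 2 elements; with minimal support in the full complement C^⊥ the claim fails for weak F-matroids (e.g. on U_{3,6} with trivial G and N_G = {0, 1+1, 1+1+1}). *)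

theory Defs
  imports "HOL-Algebra.Group" "HOL-Library.Multiset"
begin

section \<open>Tracts\<close>

text \<open>
  A tract is an abelian group \<open>G\<close> together with a set \<open>N\<^sub>G\<close> of formal sums. Elements of
  \<open>\<nat>[G]\<close> are finite multisets over the carrier of \<open>G\<close>: the empty multiset is the formal sum 0,
  multiset union is addition, and \<open>g \<in> G\<close> acts by multiplying every term.
\<close>

record 'g tract = "'g monoid" +
  nullset :: "'g multiset set"

locale tract = comm_group F for F (structure) +
  assumes nullset_closed: "A \<in> nullset F \<Longrightarrow> set_mset A \<subseteq> carrier F"
    and T0: "{#} \<in> nullset F"
    and T1: "{#\<one>#} \<notin> nullset F"
    and T2: "\<exists>!x. x \<in> carrier F \<and> {#\<one>, x#} \<in> nullset F"
    and T3: "\<lbrakk>g \<in> carrier F; A \<in> nullset F\<rbrakk> \<Longrightarrow> image_mset (\<lambda>x. g \<otimes> x) A \<in> nullset F"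

text \<open>
  The underlying set \<open>F = G \<union> {0}\<close> of a tract lives in the type \<^typ>\<open>'g option\<close>, with
  \<^const>\<open>None\<close> as zero element.
\<close>

definition tract_set :: "'g tract \<Rightarrow> 'g option set" where
  "tract_set F = insert None (Some ` carrier F)"

definition tmult :: "'g tract \<Rightarrow> 'g option \<Rightarrow> 'g option \<Rightarrow> 'g option" where
  "tmult F x y = (case (x, y) of (Some a, Some b) \<Rightarrow> Some (a \<otimes>\<^bsub>F\<^esub> b) | _ \<Rightarrow> None)"

definition tract_eps :: "'g tract \<Rightarrow> 'g" where
  "tract_eps F = (THE x. x \<in> carrier F \<and> {#\<one>\<^bsub>F\<^esub>, x#} \<in> nullset F)"

definition tneg :: "'g tract \<Rightarrow> 'g option \<Rightarrow> 'g option" where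
  "tneg F x = tmult F (Some (tract_eps F)) x"

text \<open>An element of \<open>F\<close> as a formal sum; zeros are omitted.\<close>

definition formal :: "'g option \<Rightarrow> 'g multiset" where
  "formal x = (case x of None \<Rightarrow> {#} | Some g \<Rightarrow> {#g#})"

text \<open>A tract homomorphism is given on the groups of units and extended by \<open>0 \<mapsto> 0\<close>.\<close>

definition tract_hom :: "'g tract \<Rightarrow> 'h tract \<Rightarrow> ('g \<Rightarrow> 'h) set" where
  "tract_hom F F' = {h \<in> hom F F'. \<forall>A\<in>nullset F. image_mset h A \<in> nullset F'}"

definition tract_involution :: "'g tract \<Rightarrow> ('g \<Rightarrow> 'g) \<Rightarrow> bool" where
  "tract_involution F \<sigma> \<longleftrightarrow> \<sigma> \<in> tract_hom F F \<and> (\<forall>x\<in>carrier F. \<sigma> (\<sigma> x) = x)"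


section \<open>Vectors over a tract\<close>

text \<open>Elements of \<open>F\<^sup>E\<close> are functions on the whole type that vanish outside \<open>E\<close>.\<close>

definition vecs :: "'g tract \<Rightarrow> 'e set \<Rightarrow> ('e \<Rightarrow> 'g option) set" where
  "vecs F E = {X. (\<forall>e\<in>E. X e \<in> tract_set F) \<and> (\<forall>e. e \<notin> E \<longrightarrow> X e = None)}"

definition zero_vec :: "'e \<Rightarrow> 'g option" where
  "zero_vec = (\<lambda>e. None)"

definition supp :: "('e \<Rightarrow> 'g option) \<Rightarrow> 'e set" where
  "supp X = {e. X e \<noteq> None}"

definition scale :: "'g tract \<Rightarrow> 'g \<Rightarrow> ('e \<Rightarrow> 'g option) \<Rightarrow> 'e \<Rightarrow> 'g option" where
  "scale F \<alpha> X = (\<lambda>e. tmult F (Some \<alpha>) (X e))"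

definition orth :: "'g tract \<Rightarrow> ('g \<Rightarrow> 'g) \<Rightarrow> 'e set \<Rightarrow> ('e \<Rightarrow> 'g option) \<Rightarrow> ('e \<Rightarrow> 'g option) \<Rightarrow> bool"
  where
  "orth F \<sigma> E X Y \<longleftrightarrow> (\<Sum>e\<in>E. formal (tmult F (X e) (map_option \<sigma> (Y e)))) \<in> nullset F"


section \<open>Matroids\<close>

record 'e set_system =
  ground :: "'e set"
  indeps :: "'e set set"

locale matroid =
  fixes M :: "'e set_system"
  assumes finite_ground: "finite (ground M)"
    and indep_subset: "I \<in> indeps M \<Longrightarrow> I \<subseteq> ground M"
    and empty_indep: "{} \<in> indeps M"
    and indep_mono: "\<lbrakk>I \<in> indeps M; J \<subseteq> I\<rbrakk> \<Longrightarrow> J \<in> indeps M"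
    and augment: "\<lbrakk>I \<in> indeps M; J \<in> indeps M; card I < card J\<rbrakk>
                  \<Longrightarrow> \<exists>x\<in>J - I. insert x I \<in> indeps M"

definition bases :: "'e set_system \<Rightarrow> 'e set set" where
  "bases M = {B \<in> indeps M. \<forall>I\<in>indeps M. B \<subseteq> I \<longrightarrow> I = B}"

definition circuits :: "'e set_system \<Rightarrow> 'e set set" where
  "circuits M = {S. S \<subseteq> ground M \<and> S \<notin> indeps M \<and> (\<forall>T. T \<subset> S \<longrightarrow> T \<in> indeps M)}"

definition dual :: "'e set_system \<Rightarrow> 'e set_system" where
  "dual M = \<lparr>ground = ground M, indeps = {I. \<exists>B\<in>bases M. I \<subseteq> ground M - B}\<rparr>"


section \<open>Signatures and weak matroids over a tract\<close>

definition scalar_rel ::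
  "'g tract \<Rightarrow> ('e \<Rightarrow> 'g option) set \<Rightarrow> (('e \<Rightarrow> 'g option) \<times> ('e \<Rightarrow> 'g option)) set" where
  "scalar_rel F C = {(X, Y). X \<in> C \<and> Y \<in> C \<and> (\<exists>\<alpha>\<in>carrier F. X = scale F \<alpha> Y)}"

text \<open>The supports are constant on a scalar class \<open>K\<close>, so \<open>the_elem (supp ` K)\<close> is the induced map.\<close>

definition tract_signature :: "'g tract \<Rightarrow> 'e set_system \<Rightarrow> ('e \<Rightarrow> 'g option) set \<Rightarrow> bool" where
  "tract_signature F M C \<longleftrightarrow>
     C \<subseteq> vecs F (ground M) \<and>
     zero_vec \<notin> C \<and>
     (\<forall>\<alpha>\<in>carrier F. \<forall>X\<in>C. scale F \<alpha> X \<in> C) \<and>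
     bij_betw (\<lambda>K. the_elem (supp ` K)) (C // scalar_rel F C) (circuits M)"

definition modular_pair ::
  "('e \<Rightarrow> 'g option) set \<Rightarrow> ('e \<Rightarrow> 'g option) \<Rightarrow> ('e \<Rightarrow> 'g option) \<Rightarrow> bool" where
  "modular_pair C X Y \<longleftrightarrow>
     supp X \<noteq> supp Y \<and>
     \<not> (\<exists>X'\<in>C. \<exists>Y'\<in>C. supp X' \<noteq> supp Y' \<and> supp X' \<union> supp Y' \<subset> supp X \<union> supp Y)"

definition weak_tract_matroid :: "'g tract \<Rightarrow> 'e set \<Rightarrow> ('e \<Rightarrow> 'g option) set \<Rightarrow> bool" where
  "weak_tract_matroid F E C \<longleftrightarrow>
     C \<subseteq> vecs F E \<and>
     zero_vec \<notin> C \<and>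
     (\<forall>\<alpha>\<in>carrier F. \<forall>X\<in>C. scale F \<alpha> X \<in> C) \<and>
     (\<forall>X\<in>C. \<forall>Y\<in>C. supp X \<subseteq> supp Y \<longrightarrow> (\<exists>\<alpha>\<in>carrier F. X = scale F \<alpha> Y)) \<and>
     (\<forall>X\<in>C. \<forall>Y\<in>C. \<forall>e\<in>E. modular_pair C X Y \<and> X e = tneg F (Y e) \<and> X e \<noteq> None \<longrightarrow>
        (\<exists>Z\<in>C. Z e = None \<and>
           (\<forall>f\<in>E. formal (X f) + formal (Y f) + formal (tneg F (Z f)) \<in> nullset F)))"

definition has_underlying_matroid :: "('e \<Rightarrow> 'g option) set \<Rightarrow> 'e set_system \<Rightarrow> bool" where
  "has_underlying_matroid C M \<longleftrightarrow> supp ` C = circuits M"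

text \<open>
  The \<open>F\<close>-circuits of the dual of a weak \<open>F\<close>-matroid with \<open>F\<close>-circuit set \<open>C\<close>. An \<open>F\<close>-circuit \<open>Y\<close> of
  the dual is determined up to a scalar by its ratios: if the support of \<open>X \<in> C\<close> meets that of
  \<open>Y\<close> in exactly \<open>{e, f}\<close>, then \<open>X(e) \<sigma>(Y(e)) = - X(f) \<sigma>(Y(f))\<close>, i.e. \<open>X \<bottom> Y\<close>; and the two supports
  never meet in a single element. The dual thus consists of the vectors of minimal nonempty support
  in the complement of \<open>C\<close>, where orthogonality is imposed for intersections of size at most 2.

  Pitfall: orthogonality to all of \<open>C\<close> characterizes the dual only for strong \<open>F\<close>-matroids. Let \<open>G\<close>
  be trivial and \<open>N\<^sub>G\<close> consist of the formal sums 0, 1 + 1 and 1 + 1 + 1. The vectors supported on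
  the 4-subsets of a 6-set form a self-dual weak \<open>F\<close>-matroid with underlying matroid \<open>U\<^bsub>3,6\<^esub>\<close>,
  but only the zero vector is orthogonal to all of them. For a strong \<open>F\<close>-matroid the elements of
  minimal nonempty support in \<open>C\<^sup>\<bottom>\<close> are exactly the vectors below.
\<close>

definition perp2 ::
  "'g tract \<Rightarrow> ('g \<Rightarrow> 'g) \<Rightarrow> 'e set \<Rightarrow> ('e \<Rightarrow> 'g option) set \<Rightarrow> ('e \<Rightarrow> 'g option) set" where
  "perp2 F \<sigma> E C =
     {Y \<in> vecs F E. \<forall>X\<in>C. card (supp X \<inter> supp Y) \<le> 2 \<longrightarrow> orth F \<sigma> E X Y}"

definition tract_cocircuits ::
  "'g tract \<Rightarrow> ('g \<Rightarrow> 'g) \<Rightarrow> 'e set \<Rightarrow> ('e \<Rightarrow> 'g option) set \<Rightarrow> ('e \<Rightarrow> 'g option) set" where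
  "tract_cocircuits F \<sigma> E C =
     {Y \<in> perp2 F \<sigma> E C - {zero_vec}.
        \<not> (\<exists>Y'\<in>perp2 F \<sigma> E C - {zero_vec}. supp Y' \<subset> supp Y)}"

end

theory Submission
  imports Defs
begin

text \<open>
  If orthogonality holds for intersections of size at most 3, let \<open>X\<close>, \<open>Y\<close> be a modular pair and
  \<open>A\<close> the union of their supports. Any two distinct circuits inside \<open>A\<close> cover \<open>A\<close>, so \<open>A\<close> minus a
  suitable pair of elements is independent and \<open>A\<close> meets suitable cocircuits in prescribed sets of
  two or three elements. Orthogonality to these cocircuits compares the entries of \<open>X\<close>, \<open>Y\<close> and of
  the circuit \<open>Z\<close> avoiding \<open>e\<close>, scaled to agree with \<open>X\<close> at one element outside \<open>Y\<close>: this is modular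
  elimination. Conversely, if \<open>X \<in> C\<close> and \<open>Y \<in> D\<close> meet in \<open>{e, f, g}\<close>, then \<open>X\<close> is, up to a scalar,
  obtained by modular elimination from circuits meeting \<open>Y\<close> in \<open>{e, g}\<close> and \<open>{f, g}\<close>; adding the two
  corresponding 2-term orthogonality relations gives the 3-term one.
\<close>

section \<open>Circuits and cocircuits of a matroid\<close>

text \<open>Stated outside the locale \<open>matroid\<close> so that it also applies to
  \<open>dual M\<close>, without a proof that the dual satisfies the matroid axioms.\<close>

lemma contains_circuit:
  assumes "finite (ground M)" "S \<subseteq> ground M" "S \<notin> indeps M"
  obtains T where "T \<in> circuits M" "T \<subseteq> S"
proof -
  define U where "U = {T. T \<subseteq> S \<and> T \<notin> indeps M}"
  have "finite S"
    using assms(1,2) by (rule rev_finite_subset)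
  then have "finite U"
    unfolding U_def by simp
  moreover have "S \<in> U"
    using assms(3) U_def by simp
  ultimately obtain T where T: "T \<in> U" and min: "\<forall>T'\<in>U. T' \<subseteq> T \<longrightarrow> T = T'"
    using finite_has_minimal2[of U S] by metis
  have "T' \<in> indeps M" if "T' \<subset> T" for T'
    using that T min unfolding U_def by blast
  then have "T \<in> circuits M" "T \<subseteq> S"
    using T assms(2) unfolding circuits_def U_def by auto
  then show thesis using that by blast
qed

lemma circuit_subset_eq:
  "\<lbrakk>S \<in> circuits M; T \<in> circuits M; S \<subseteq> T\<rbrakk> \<Longrightarrow> S = T"
  unfolding circuits_def by blast

lemma ground_dual [simp]: "ground (dual M) = ground M"
  by (simp add: dual_def)

lemma indeps_dual: "I \<in> indeps (dual M) \<longleftrightarrow> (\<exists>B\<in>bases M. I \<subseteq> ground M - B)"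
  by (simp add: dual_def)

context matroid
begin

section \<open>Independent sets and bases\<close>

lemma finite_indep: "I \<in> indeps M \<Longrightarrow> finite I"
  using indep_subset finite_ground finite_subset by blast

lemma circuit_finite: "S \<in> circuits M \<Longrightarrow> finite S"
  unfolding circuits_def using finite_ground finite_subset by blast

lemma circuit_indep_minus: "\<lbrakk>S \<in> circuits M; x \<in> S\<rbrakk> \<Longrightarrow> S - {x} \<in> indeps M"
  unfolding circuits_def by auto

lemma circuit_not_subset_indep: "\<lbrakk>S \<in> circuits M; I \<in> indeps M\<rbrakk> \<Longrightarrow> \<not> S \<subseteq> I"
  unfolding circuits_def using indep_mono by blast

text \<open>Repeated augmentation. In later uses \<open>I\<close> is a circuit minus one element
  \<open>x\<close>; the extension \<open>K\<close> then cannot contain \<open>x\<close>, because it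
  would contain the whole circuit.\<close>

lemma extend_indep:
  assumes "I \<in> indeps M" "J \<in> indeps M"
  obtains K where "K \<in> indeps M" "I \<subseteq> K" "K \<subseteq> I \<union> J" "card J \<le> card K"
proof -
  have "\<exists>K\<in>indeps M. I \<subseteq> K \<and> K \<subseteq> I \<union> J \<and> card J \<le> card K"
    using assms(1)
  proof (induction "card J - card I" arbitrary: I rule: less_induct)
    case less
    show ?case
    proof (cases "card I < card J")
      case True
      then obtain x where x: "x \<in> J - I" "insert x I \<in> indeps M"
        using augment less.prems assms(2) by blast
      have "card (insert x I) = Suc (card I)"
        using x finite_indep[OF less.prems] by simp
      then have "card J - card (insert x I) < card J - card I"
        using True by simp
      from less.hyps[OF this x(2)] obtain K
        where "K \<in> indeps M" "insert x I \<subseteq> K" "K \<subseteq> insert x I \<union> J" "card J \<le> card K"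
        by (elim bexE conjE)
      moreover from this have "I \<subseteq> K" "K \<subseteq> I \<union> J"
        using x(1) by blast+
      ultimately show ?thesis by blast
    next
      case False
      then have "I \<subseteq> I \<and> I \<subseteq> I \<union> J \<and> card J \<le> card I" by simp
      with less.prems show ?thesis by (rule rev_bexI)
    qed
  qed
  then show thesis using that by blast
qed

lemma basis_indep: "B \<in> bases M \<Longrightarrow> B \<in> indeps M"
  by (simp add: bases_def)

lemma indep_card_le_basis:
  assumes "B \<in> bases M" "I \<in> indeps M"
  shows "card I \<le> card B"
proof (rule ccontr)
  assume "\<not> card I \<le> card B"
  then obtain x where "x \<in> I - B" "insert x B \<in> indeps M"
    using augment assms basis_indep by (metis not_le)
  then show False
    using assms(1) unfolding bases_def by blast
qed

lemma indep_card_ge_basis: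
  assumes "B \<in> bases M" "I \<in> indeps M" "card B \<le> card I"
  shows "I \<in> bases M"
proof -
  have "J = I" if "J \<in> indeps M" "I \<subseteq> J" for J
    using indep_card_le_basis[OF assms(1) that(1)] assms(3) that finite_indep
    by (metis card_seteq le_trans)
  then show ?thesis
    unfolding bases_def using assms(2) by blast
qed

lemma indep_in_basis:
  assumes "I \<in> indeps M"
  obtains B where "B \<in> bases M" "I \<subseteq> B"
proof -
  have "indeps M \<subseteq> Pow (ground M)"
    using indep_subset by blast
  then have "finite (indeps M)"
    using finite_ground by (meson finite_Pow_iff finite_subset)
  from finite_has_maximal2[OF this assms] obtain B
    where "B \<in> indeps M" "I \<subseteq> B" "\<forall>J\<in>indeps M. B \<subseteq> J \<longrightarrow> B = J"
    by (elim bexE conjE)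
  then have "B \<in> bases M"
    by (auto simp: bases_def)
  then show thesis
    using \<open>I \<subseteq> B\<close> that by simp
qed

text \<open>The set \<open>A\<close> has corank at most one. If \<open>c\<close> lies in
  \<open>S\<close> but not in \<open>T\<close>, extending \<open>S - {c}\<close> to at least the
  size of \<open>I\<close> without using \<open>c\<close> fills up all of \<open>A - {c}\<close>,
  and this independent set would contain \<open>T\<close>.\<close>

lemma circuit_unique:
  assumes I: "I \<in> indeps M" "I \<subseteq> A" and A: "finite A" "card A \<le> Suc (card I)"
    and S: "S \<in> circuits M" "S \<subseteq> A" and T: "T \<in> circuits M" "T \<subseteq> A"
  shows "S = T"
proof (rule ccontr)
  assume "S \<noteq> T"
  then obtain c where c: "c \<in> S" "c \<notin> T"
    using circuit_subset_eq S T by blast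
  obtain K where K: "K \<in> indeps M" "S - {c} \<subseteq> K" "K \<subseteq> S - {c} \<union> I" "card I \<le> card K"
    using extend_indep[OF circuit_indep_minus[OF S(1) c(1)] I(1)] by blast
  have "c \<notin> K"
    using circuit_not_subset_indep[OF S(1) K(1)] K(2) by blast
  then have sub: "K \<subseteq> A - {c}"
    using K(3) S I by blast
  moreover have "card (A - {c}) \<le> card K"
    using A c S K(4) by (simp add: subset_iff)
  ultimately have "K = A - {c}"
    using A by (meson card_seteq finite_Diff)
  then show False
    using circuit_not_subset_indep[OF T(1) K(1)] T c by blast
qed

text \<open>In a set of corank 2, removing an element of a circuit drops the corank to 1.\<close>

lemma circuit_unique_corank_two:
  assumes I: "I \<in> indeps M" "I \<subseteq> A" and A: "finite A" "card A \<le> Suc (Suc (card I))"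
    and R: "R \<in> circuits M" "R \<subseteq> A" "x \<in> R"
    and S: "S \<in> circuits M" "S \<subseteq> A - {x}" and T: "T \<in> circuits M" "T \<subseteq> A - {x}"
  shows "S = T"
proof -
  obtain K where K: "K \<in> indeps M" "R - {x} \<subseteq> K" "K \<subseteq> R - {x} \<union> I" "card I \<le> card K"
    using extend_indep[OF circuit_indep_minus[OF R(1,3)] I(1)] by blast
  have "x \<notin> K"
    using circuit_not_subset_indep[OF R(1) K(1)] K(2) by blast
  then have "K \<subseteq> A - {x}"
    using K(3) R I by blast
  moreover have "card (A - {x}) \<le> Suc (card K)"
    using A R K(4) by (auto simp: subset_iff)
  ultimately show ?thesis
    using circuit_unique[OF K(1) _ _ _ S T] A by simp
qed

text \<open>Were \<open>S \<union> T - {e}\<close> independent, \<open>S \<union> T\<close> would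
  have corank at most one and \<open>circuit_unique\<close> would give \<open>S = T\<close>.\<close>

lemma circuit_elimination:
  assumes "S \<in> circuits M" "T \<in> circuits M" "S \<noteq> T" "e \<in> S"
  obtains R where "R \<in> circuits M" "R \<subseteq> S \<union> T - {e}"
proof (cases "S \<union> T - {e} \<in> indeps M")
  case True
  have "finite (S \<union> T)"
    using assms circuit_finite by blast
  moreover from this have "card (S \<union> T) \<le> Suc (card (S \<union> T - {e}))"
    using assms(4) by (simp add: card_Suc_Diff1)
  ultimately have "S = T"
    using circuit_unique[OF True _ _ _ assms(1) _ assms(2), of "S \<union> T"] by blast
  with assms(3) show thesis by blast
next
  case False
  have "S \<union> T - {e} \<subseteq> ground M"
    using assms unfolding circuits_def by blast
  show thesis
    by (rule contains_circuit[OF finite_ground \<open>S \<union> T - {e} \<subseteq> ground M\<close> False]) (rule that)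
qed

lemma fundamental_circuit:
  assumes "I \<in> indeps M" "x \<in> ground M" "insert x I \<notin> indeps M"
  obtains S where "S \<in> circuits M" "S \<subseteq> insert x I" "x \<in> S"
proof -
  have "insert x I \<subseteq> ground M"
    using assms indep_subset by blast
  from contains_circuit[OF finite_ground this assms(3)] obtain S
    where S: "S \<in> circuits M" "S \<subseteq> insert x I" .
  moreover have "x \<in> S"
    using circuit_not_subset_indep[OF S(1) assms(1)] S(2) by blast
  ultimately show thesis using that by blast
qed

text \<open>Extend \<open>I\<close> to a basis \<open>B\<close>. A basis avoiding both
  \<open>b\<close> and the complement of \<open>B\<close> would be a proper subset of
  \<open>B\<close>, so \<open>b\<close> together with that complement contains a cocircuit. It
  passes through \<open>b\<close>, as the complement alone is coindependent.\<close>

lemma fundamental_cocircuit: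
  assumes "I \<in> indeps M" "b \<in> I"
  obtains T where "T \<in> circuits (dual M)" "T \<inter> I = {b}"
proof -
  obtain B where B: "B \<in> bases M" "I \<subseteq> B"
    using indep_in_basis[OF assms(1)] .
  have dep: "insert b (ground M - B) \<notin> indeps (dual M)"
  proof
    assume "insert b (ground M - B) \<in> indeps (dual M)"
    then obtain B' where B': "B' \<in> bases M" "insert b (ground M - B) \<subseteq> ground M - B'"
      unfolding indeps_dual by blast
    moreover have "B' \<subseteq> ground M"
      using B' basis_indep indep_subset by blast
    ultimately have "B' \<subseteq> B" "b \<notin> B'"
      by blast+
    then show False
      using B'(1) basis_indep[OF B(1)] B(2) assms(2) unfolding bases_def by blast
  qed
  have "finite (ground (dual M))" "insert b (ground M - B) \<subseteq> ground (dual M)"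
    using assms indep_subset finite_ground by auto
  from contains_circuit[OF this dep] obtain T
    where T: "T \<in> circuits (dual M)" "T \<subseteq> insert b (ground M - B)" .
  have "T \<notin> indeps (dual M)"
    using T(1) by (simp add: circuits_def)
  then have "\<not> T \<subseteq> ground M - B"
    using B(1) by (auto simp: indeps_dual)
  then have "b \<in> T"
    using T(2) by blast
  then have "T \<inter> I = {b}"
    using T(2) B(2) assms(2) by blast
  with T(1) show thesis using that by blast
qed

section \<open>Intersections of circuits with cocircuits\<close>

lemma cocircuit_basis:
  assumes "T \<in> circuits (dual M)" "x \<in> T"
  obtains B where "B \<in> bases M" "B \<inter> T = {x}"
proof -
  have "T - {x} \<in> indeps (dual M)"
    using assms unfolding circuits_def by blast
  then obtain B where B: "B \<in> bases M" "T - {x} \<subseteq> ground M - B"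
    unfolding indeps_dual by blast
  have "T \<subseteq> ground M" "T \<notin> indeps (dual M)"
    using assms unfolding circuits_def by auto
  then have "x \<in> B"
    using B assms(2) unfolding indeps_dual by blast
  then have "B \<inter> T = {x}"
    using B(2) assms(2) by blast
  with B(1) show thesis using that by blast
qed

lemma basis_meets_cocircuit:
  assumes "T \<in> circuits (dual M)" "B \<in> bases M"
  shows "B \<inter> T \<noteq> {}"
  using assms unfolding circuits_def indeps_dual by auto

text \<open>By exchange, \<open>S - {x}\<close> extends to a basis \<open>K\<close> that avoids
  \<open>x\<close> and takes its other elements from a basis meeting \<open>T\<close> only in
  \<open>x\<close>. Such a \<open>K\<close> misses \<open>T\<close>, but every basis meets every
  cocircuit.\<close>

lemma circuit_cocircuit_inter:
  assumes "S \<in> circuits M" "T \<in> circuits (dual M)"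
  shows "S \<inter> T \<noteq> {x}"
proof
  assume x: "S \<inter> T = {x}"
  then have xST: "x \<in> S" "x \<in> T" by auto
  obtain B where B: "B \<in> bases M" "B \<inter> T = {x}"
    using cocircuit_basis[OF assms(2) xST(2)] .
  obtain K where K: "K \<in> indeps M" "S - {x} \<subseteq> K" "K \<subseteq> S - {x} \<union> B" "card B \<le> card K"
    using extend_indep[OF circuit_indep_minus[OF assms(1) xST(1)] basis_indep[OF B(1)]] .
  have "x \<notin> K"
    using circuit_not_subset_indep[OF assms(1) K(1)] K(2) by blast
  moreover have "K \<inter> T \<noteq> {}"
    using basis_meets_cocircuit[OF assms(2) indep_card_ge_basis[OF B(1) K(1,4)]] .
  moreover have "K \<inter> T \<subseteq> S \<inter> T \<union> B \<inter> T"
    using K(3) by blast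
  ultimately show False
    unfolding x B(2) by auto
qed

text \<open>The set \<open>L\<close> has rank one less than \<open>M\<close> and avoids
  \<open>T\<close>. Augmenting it from a basis that meets \<open>T\<close> only in \<open>d\<close>
  yields a basis, which must meet \<open>T\<close>; hence the added element is
  \<open>d\<close>.\<close>

lemma insert_cocircuit_indep:
  assumes T: "T \<in> circuits (dual M)" "d \<in> T"
    and L: "L \<in> indeps M" "L \<inter> T = {}" and B: "B \<in> bases M" "card B = Suc (card L)"
  shows "insert d L \<in> indeps M"
proof -
  obtain B' where B': "B' \<in> bases M" "B' \<inter> T = {d}"
    using cocircuit_basis[OF T] .
  have "card B' = card B"
    using B B' indep_card_le_basis basis_indep le_antisym by metis
  then obtain x where x: "x \<in> B' - L" "insert x L \<in> indeps M"
    using augment[OF L(1) basis_indep[OF B'(1)]] B(2) by auto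
  have "insert x L \<in> bases M"
    using indep_card_ge_basis[OF B(1) x(2)] x(1) B(2) finite_indep[OF L(1)] by simp
  then have "x \<in> T"
    using basis_meets_cocircuit[OF T(1)] L(2) by blast
  then have "x = d"
    using B'(2) x(1) by blast
  with x(2) show ?thesis by simp
qed

text \<open>Adding \<open>e\<close> to \<open>L\<close> gives a basis, so adding \<open>f\<close> as
  well creates a fundamental circuit through \<open>f\<close>. It cannot meet \<open>T\<close> in
  \<open>f\<close> alone, so it contains \<open>e\<close>.\<close>

lemma circuit_through_two:
  assumes T: "T \<in> circuits (dual M)" "e \<in> T" "f \<in> T" "e \<noteq> f"
    and L: "L \<in> indeps M" "L \<inter> T = {}" and B: "B \<in> bases M" "card B = Suc (card L)"
  obtains S where "S \<in> circuits M" "S \<subseteq> insert e (insert f L)" "S \<inter> T = {e, f}"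
proof -
  have fin: "finite L"
    using L finite_indep by blast
  have ne: "e \<notin> L" "f \<notin> L"
    using L(2) T by auto
  have e: "insert e L \<in> indeps M"
    using insert_cocircuit_indep[OF T(1,2) L B] .
  have "insert f (insert e L) \<notin> indeps M"
  proof
    assume "insert f (insert e L) \<in> indeps M"
    from indep_card_le_basis[OF B(1) this] show False
      using B(2) fin ne by (simp add: T(4)[symmetric])
  qed
  moreover have "f \<in> ground M"
    using T unfolding circuits_def by auto
  ultimately obtain S where S: "S \<in> circuits M" "S \<subseteq> insert f (insert e L)" "f \<in> S"
    using fundamental_circuit[OF e] by blast
  have "S \<inter> T \<noteq> {f}"
    using circuit_cocircuit_inter[OF S(1) T(1)] .
  then have "S \<inter> T = {e, f}"
    using S L(2) T by blast
  with S show thesis using that by blast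
qed

text \<open>Provides the circuits that test the ratio of two entries of a vector supported on a
  cocircuit. The independent set used is a basis meeting \<open>T\<close> only in \<open>e\<close>,
  with \<open>e\<close> removed.\<close>

lemma cocircuit_two_circuit:
  assumes "T \<in> circuits (dual M)" "e \<in> T" "f \<in> T" "e \<noteq> f"
  obtains S where "S \<in> circuits M" "S \<inter> T = {e, f}"
proof -
  obtain B where B: "B \<in> bases M" "B \<inter> T = {e}"
    using cocircuit_basis[OF assms(1,2)] .
  have L: "B - {e} \<in> indeps M" "(B - {e}) \<inter> T = {}"
    using B basis_indep[OF B(1)] indep_mono by blast+
  have "card B = Suc (card (B - {e}))"
    using B finite_indep[OF basis_indep[OF B(1)]] by (metis Int_iff card_Suc_Diff1 insertI1)
  then show thesis
    by (rule circuit_through_two[OF assms L B(1)]) (rule that)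
qed

text \<open>The circuit is the fundamental circuit of \<open>x\<close> with respect to a basis
  disjoint from \<open>S\<close>. Such one-element intersections rule out coindependent supports in
  \<open>perp2\<close>.\<close>

lemma coindependent_circuit_inter:
  assumes "S \<in> indeps (dual M)" "x \<in> S"
  obtains R where "R \<in> circuits M" "R \<inter> S = {x}"
proof -
  obtain B where B: "B \<in> bases M" "S \<subseteq> ground M - B"
    using assms(1) unfolding indeps_dual by blast
  have "x \<in> ground M" "x \<notin> B"
    using assms(2) B(2) by auto
  moreover from this have "insert x B \<notin> indeps M"
    using B(1) unfolding bases_def by blast
  ultimately obtain R where "R \<in> circuits M" "R \<subseteq> insert x B" "x \<in> R"
    using fundamental_circuit[OF basis_indep[OF B(1)]] by blast
  then show thesis
    using that B(2) assms(2) by blast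
qed

text \<open>Contracting a suitable independent set of rank two less than \<open>M\<close> turns \<open>S\<close> into a triangle
  on a line that meets the complement of \<open>T\<close> in the point \<open>h\<close>; the circuits \<open>S\<^sub>1\<close> and \<open>S\<^sub>2\<close>
  are two further triangles on that line.\<close>

lemma circuit_cocircuit_three:
  assumes S: "S \<in> circuits M" and T: "T \<in> circuits (dual M)"
    and ST: "S \<inter> T = {e, f, g}" and ne: "e \<noteq> f" "e \<noteq> g" "f \<noteq> g"
  obtains S\<^sub>1 S\<^sub>2 h where "S\<^sub>1 \<in> circuits M" "S\<^sub>2 \<in> circuits M"
    "S\<^sub>1 \<inter> T = {e, g}" "S\<^sub>2 \<inter> T = {f, g}" "h \<in> S\<^sub>1" "h \<in> S\<^sub>2"
    "\<And>R R'. \<lbrakk>R \<in> circuits M; R' \<in> circuits M; R \<union> R' \<subset> S\<^sub>1 \<union> S\<^sub>2\<rbrakk> \<Longrightarrow> R = R'"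
    "\<And>R. \<lbrakk>R \<in> circuits M; R \<subseteq> S\<^sub>1 \<union> S\<^sub>2 - {h}\<rbrakk> \<Longrightarrow> R = S"
proof -
  have mem: "e \<in> T" "f \<in> T" "g \<in> T" "e \<in> S" "f \<in> S" "g \<in> S"
    using ST by auto
  obtain B where B: "B \<in> bases M" "B \<inter> T = {e}"
    using cocircuit_basis[OF T mem(1)] .
  \<comment> \<open>A basis containing \<open>S - {g}\<close>. It omits \<open>g\<close>, and
    outside \<open>S\<close> it uses only elements of \<open>B\<close>, so it meets \<open>T\<close>
    only in \<open>e\<close> and \<open>f\<close>.\<close>
  obtain K where K: "K \<in> indeps M" "S - {g} \<subseteq> K" "K \<subseteq> S - {g} \<union> B" "card B \<le> card K"
    using extend_indep[OF circuit_indep_minus[OF S mem(6)] basis_indep[OF B(1)]] .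
  have finK: "finite K"
    using K(1) finite_indep by blast
  have gK: "g \<notin> K"
    using circuit_not_subset_indep[OF S K(1)] K(2) by blast
  have cardK: "card K = card B"
    using K(4) indep_card_le_basis[OF B(1) K(1)] by simp
  define J where "J = K - {e, f}"
  have KJ: "K = insert e (insert f J)" and efJ: "e \<notin> J" "f \<notin> J" "g \<notin> J"
    using K(2) mem ne gK unfolding J_def by auto
  have finJ: "finite J" using finK J_def by simp
  have cardJ: "card K = Suc (Suc (card J))"
    using efJ ne finJ by (simp add: KJ)
  have J: "J \<in> indeps M"
    using K(1) indep_mono KJ by blast
  have JT: "J \<inter> T = {}"
    using K(3) B(2) ST efJ unfolding J_def by blast
  have B': "B - {e} \<in> indeps M"
    using basis_indep[OF B(1)] indep_mono by blast
  have "card (B - {e}) = Suc (card J)"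
    using cardJ cardK B finite_indep[OF basis_indep[OF B(1)]]
    by (metis Int_iff card_Suc_Diff1 insertI1 nat.inject)
  \<comment> \<open>Augmenting from \<open>B - {e}\<close>, which is disjoint from \<open>T\<close>,
    keeps \<open>h\<close> out of \<open>T\<close>. Thus \<open>L\<close> below has rank one less
    than \<open>M\<close> and \<open>circuit_through_two\<close> applies.\<close>
  then obtain h where h: "h \<in> B - {e} - J" "insert h J \<in> indeps M"
    using augment[OF J B'] by auto
  have hT: "h \<notin> T"
    using h(1) B(2) by blast
  define L where "L = insert h J"
  have L: "L \<in> indeps M" "L \<inter> T = {}" "card B = Suc (card L)"
    using h JT hT cardJ cardK finJ unfolding L_def by auto
  obtain S\<^sub>1 where S\<^sub>1: "S\<^sub>1 \<in> circuits M" "S\<^sub>1 \<subseteq> insert e (insert g L)" "S\<^sub>1 \<inter> T = {e, g}"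
    using circuit_through_two[OF T mem(1,3) ne(2) L(1,2) B(1) L(3)] .
  obtain S\<^sub>2 where S\<^sub>2: "S\<^sub>2 \<in> circuits M" "S\<^sub>2 \<subseteq> insert f (insert g L)" "S\<^sub>2 \<inter> T = {f, g}"
    using circuit_through_two[OF T mem(2,3) ne(3) L(1,2) B(1) L(3)] .
  \<comment> \<open>The set \<open>insert g K\<close> has corank one and contains \<open>S\<close>.
    If \<open>S\<^sub>1\<close> or \<open>S\<^sub>2\<close> missed \<open>h\<close>, it would lie in
    this set and equal \<open>S\<close>, which meets \<open>T\<close> in three elements instead of
    two.\<close>
  have uniq: "R = S" if "R \<in> circuits M" "R \<subseteq> insert g K" for R
    using circuit_unique[OF K(1) _ _ _ that S] finK K(2) gK by auto
  have h1: "h \<in> S\<^sub>1"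
  proof (rule ccontr)
    assume "h \<notin> S\<^sub>1"
    then have "S\<^sub>1 = S"
      using S\<^sub>1 by (intro uniq) (auto simp: KJ L_def)
    then show False using S\<^sub>1(3) ST ne by auto
  qed
  have h2: "h \<in> S\<^sub>2"
  proof (rule ccontr)
    assume "h \<notin> S\<^sub>2"
    then have "S\<^sub>2 = S"
      using S\<^sub>2 by (intro uniq) (auto simp: KJ L_def)
    then show False using S\<^sub>2(3) ST ne by auto
  qed
  \<comment> \<open>This set has corank at most two, which makes \<open>S\<^sub>1\<close> and
    \<open>S\<^sub>2\<close> the supports of a modular pair.\<close>
  define A where "A = insert h (insert g K)"
  have A: "finite A" "K \<subseteq> A" "card A \<le> Suc (Suc (card K))" "S\<^sub>1 \<subseteq> A" "S\<^sub>2 \<subseteq> A"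
    using finK S\<^sub>1(2) S\<^sub>2(2) unfolding A_def by (auto simp: card_insert_if KJ L_def)
  show thesis
  proof (rule that[OF S\<^sub>1(1) S\<^sub>2(1) S\<^sub>1(3) S\<^sub>2(3) h1 h2])
    fix R R' assume R: "R \<in> circuits M" "R' \<in> circuits M" "R \<union> R' \<subset> S\<^sub>1 \<union> S\<^sub>2"
    then obtain x where x: "x \<in> S\<^sub>1 \<union> S\<^sub>2" "x \<notin> R \<union> R'"
      by blast
    then have "R \<subseteq> A - {x}" "R' \<subseteq> A - {x}"
      using R(3) A(4,5) by blast+
    then show "R = R'"
      using x(1) circuit_unique_corank_two[OF K(1) A(2,1,3) S\<^sub>1(1) A(4) _ R(1) _ R(2)]
        circuit_unique_corank_two[OF K(1) A(2,1,3) S\<^sub>2(1) A(5) _ R(1) _ R(2)] by blast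
  next
    fix R assume "R \<in> circuits M" "R \<subseteq> S\<^sub>1 \<union> S\<^sub>2 - {h}"
    then show "R = S"
      using A(4,5) by (intro uniq) (auto simp: A_def)
  qed
qed

end

section \<open>Orthogonality over a tract\<close>

locale involutive_tract = tract F for F :: "'g tract" (structure) +
  fixes \<sigma> :: "'g \<Rightarrow> 'g"
  assumes involution: "tract_involution F \<sigma>"
begin

section \<open>Negation and null sums of up to three terms\<close>

abbreviation eps :: 'g where "eps \<equiv> tract_eps F"

lemma eps_closed [simp]: "eps \<in> carrier F" and eps_null: "{#\<one>, eps#} \<in> nullset F"
  using theI'[OF T2] unfolding tract_eps_def by auto

lemma eps_unique: "\<lbrakk>x \<in> carrier F; {#\<one>, x#} \<in> nullset F\<rbrakk> \<Longrightarrow> x = eps"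
  using T2 eps_closed eps_null by blast

lemma scale_null_iff:
  assumes "g \<in> carrier F" "set_mset A \<subseteq> carrier F"
  shows "image_mset ((\<otimes>) g) A \<in> nullset F \<longleftrightarrow> A \<in> nullset F"
proof
  assume "image_mset ((\<otimes>) g) A \<in> nullset F"
  then have "image_mset ((\<otimes>) (inv g)) (image_mset ((\<otimes>) g) A) \<in> nullset F"
    using T3 assms(1) by blast
  moreover have "image_mset ((\<otimes>) (inv g)) (image_mset ((\<otimes>) g) A) = image_mset id A"
    unfolding multiset.map_comp
    using assms by (intro image_mset_cong) (auto simp: m_assoc[symmetric])
  ultimately show "A \<in> nullset F" by simp
qed (use T3 assms in blast)

lemma null_single: "a \<in> carrier F \<Longrightarrow> {#a#} \<notin> nullset F"
  using scale_null_iff[of a "{#\<one>#}"] T1 by simp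

text \<open>Dividing by \<open>b\<close> reduces the claim to the uniqueness of \<open>eps\<close>
  in (T2).\<close>

lemma null_pair:
  assumes "a \<in> carrier F" "b \<in> carrier F"
  shows "{#a, b#} \<in> nullset F \<longleftrightarrow> a = eps \<otimes> b"
proof -
  have "{#a, b#} \<in> nullset F \<longleftrightarrow> {#\<one>, inv b \<otimes> a#} \<in> nullset F"
    using scale_null_iff[of b "{#\<one>, inv b \<otimes> a#}"] assms
    by (simp add: m_assoc[symmetric] add_mset_commute)
  also have "\<dots> \<longleftrightarrow> inv b \<otimes> a = eps"
    using eps_unique eps_null assms by auto
  also have "\<dots> \<longleftrightarrow> a = eps \<otimes> b"
    using assms by (metis eps_closed inv_solve_left m_comm)
  finally show ?thesis .
qed

lemma eps_eps [simp]: "eps \<otimes> eps = \<one>"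
  using null_pair[of \<one> eps] eps_null by simp

lemma eps_eps_mult: "a \<in> carrier F \<Longrightarrow> eps \<otimes> (eps \<otimes> a) = a"
  by (simp add: m_assoc[symmetric])

text \<open>Scaling by \<open>eps \<otimes> w\<close> links the two kinds of three-term relation: a
  sum of pairings, with \<open>w\<close> the conjugated entry of a cocircuit vector, and the
  condition \<open>a + b - c\<close> of modular elimination. Each direction of the theorem uses one
  implication.\<close>

lemma null_triple_neg:
  assumes [simp]: "a \<in> carrier F" "b \<in> carrier F" "c \<in> carrier F" "w \<in> carrier F"
  shows "{#eps \<otimes> (a \<otimes> w), eps \<otimes> (b \<otimes> w), c \<otimes> w#} \<in> nullset F \<longleftrightarrow>
    {#a, b, eps \<otimes> c#} \<in> nullset F"
proof -
  have "eps \<otimes> w \<otimes> (eps \<otimes> c) = eps \<otimes> (eps \<otimes> (c \<otimes> w))"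
    by (simp add: m_ac)
  then have "image_mset ((\<otimes>) (eps \<otimes> w)) {#a, b, eps \<otimes> c#} =
      {#eps \<otimes> (a \<otimes> w), eps \<otimes> (b \<otimes> w), c \<otimes> w#}"
    by (simp add: eps_eps_mult) (simp add: m_ac)
  then show ?thesis
    using scale_null_iff[of "eps \<otimes> w" "{#a, b, eps \<otimes> c#}"] by simp
qed

lemma sigma_closed [simp]: "a \<in> carrier F \<Longrightarrow> \<sigma> a \<in> carrier F"
  using involution unfolding tract_involution_def tract_hom_def hom_def by auto

lemma sigma_mult: "\<lbrakk>a \<in> carrier F; b \<in> carrier F\<rbrakk> \<Longrightarrow> \<sigma> (a \<otimes> b) = \<sigma> a \<otimes> \<sigma> b"
  using involution unfolding tract_involution_def tract_hom_def hom_def by auto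

lemma sigma_inj: "\<lbrakk>a \<in> carrier F; b \<in> carrier F; \<sigma> a = \<sigma> b\<rbrakk> \<Longrightarrow> a = b"
  using involution unfolding tract_involution_def by metis

section \<open>Supports and scalar multiples\<close>

lemma supp_eq_empty: "supp X = {} \<longleftrightarrow> X = zero_vec"
  unfolding supp_def zero_vec_def by auto

lemma supp_subset: "X \<in> vecs F E \<Longrightarrow> supp X \<subseteq> E"
  unfolding vecs_def supp_def by auto

lemma the_closed [simp]: "\<lbrakk>X \<in> vecs F E; e \<in> supp X\<rbrakk> \<Longrightarrow> the (X e) \<in> carrier F"
  unfolding vecs_def supp_def tract_set_def by (cases "e \<in> E") (auto dest!: bspec)

lemma eq_Some_the: "e \<in> supp X \<Longrightarrow> X e = Some (the (X e))"
  unfolding supp_def by auto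

lemma eq_None: "e \<notin> supp X \<Longrightarrow> X e = None"
  unfolding supp_def by auto

lemma supp_scale [simp]: "supp (scale F \<alpha> X) = supp X"
  unfolding supp_def scale_def tmult_def by (auto split: option.splits)

lemma the_scale: "e \<in> supp X \<Longrightarrow> the (scale F \<alpha> X e) = \<alpha> \<otimes> the (X e)"
  unfolding supp_def scale_def tmult_def by auto

lemma scale_eqI:
  assumes "supp X = supp Y" "\<And>e. e \<in> supp Y \<Longrightarrow> the (X e) = \<alpha> \<otimes> the (Y e)"
  shows "X = scale F \<alpha> Y"
proof
  fix e
  show "X e = scale F \<alpha> Y e"
  proof (cases "e \<in> supp Y")
    case True
    then obtain x y where "X e = Some x" "Y e = Some y"
      using assms(1) unfolding supp_def by blast
    then show ?thesis
      using assms(2)[OF True] by (simp add: scale_def tmult_def)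
  next
    case False
    then show ?thesis
      using assms(1) eq_None[of e X] eq_None[of e Y] by (simp add: scale_def tmult_def)
  qed
qed

lemma scale_one: "X \<in> vecs F E \<Longrightarrow> scale F \<one> X = X"
  by (rule scale_eqI[symmetric]) simp_all

lemma scale_scale:
  assumes "\<alpha> \<in> carrier F" "\<beta> \<in> carrier F" "X \<in> vecs F E"
  shows "scale F \<alpha> (scale F \<beta> X) = scale F (\<alpha> \<otimes> \<beta>) X"
  using assms by (intro scale_eqI) (simp_all add: the_scale m_assoc)

text \<open>One term of the orthogonality sum as a group element instead of an \<open>option\<close>
  value. It is meaningful only on the common support, where \<open>the\<close> is applied to nonzero
  entries.\<close>

definition pairing :: "('e \<Rightarrow> 'g option) \<Rightarrow> ('e \<Rightarrow> 'g option) \<Rightarrow> 'e \<Rightarrow> 'g" where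
  "pairing X Y e = the (X e) \<otimes> \<sigma> (the (Y e))"

lemma pairing_closed [simp]:
  "\<lbrakk>X \<in> vecs F E; Y \<in> vecs F E'; e \<in> supp X; e \<in> supp Y\<rbrakk> \<Longrightarrow> pairing X Y e \<in> carrier F"
  unfolding pairing_def by simp

lemma orth_iff:
  assumes "finite E" "X \<in> vecs F E" "Y \<in> vecs F E"
  shows "orth F \<sigma> E X Y \<longleftrightarrow> (\<Sum>e\<in>supp X \<inter> supp Y. {#pairing X Y e#}) \<in> nullset F"
proof -
  have "(\<Sum>e\<in>E. formal (tmult F (X e) (map_option \<sigma> (Y e)))) =
    (\<Sum>e\<in>supp X \<inter> supp Y. {#pairing X Y e#})"
    using assms supp_subset[OF assms(2)]
    by (intro sum.mono_neutral_cong_right)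
      (auto simp: supp_def formal_def tmult_def pairing_def split: option.splits)
  then show ?thesis unfolding orth_def by simp
qed

lemma orth_single:
  assumes "finite E" "X \<in> vecs F E" "Y \<in> vecs F E" "supp X \<inter> supp Y = {e}"
  shows "\<not> orth F \<sigma> E X Y"
proof -
  have "e \<in> supp X" "e \<in> supp Y" using assms(4) by auto
  then show ?thesis
    using null_single[of "pairing X Y e"] assms by (simp add: orth_iff)
qed

lemma orth_pair:
  assumes "finite E" "X \<in> vecs F E" "Y \<in> vecs F E" "supp X \<inter> supp Y = {e, f}" "e \<noteq> f"
  shows "orth F \<sigma> E X Y \<longleftrightarrow> pairing X Y e = eps \<otimes> pairing X Y f"
proof -
  have "e \<in> supp X" "e \<in> supp Y" "f \<in> supp X" "f \<in> supp Y" using assms(4) by auto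
  then show ?thesis
    using null_pair[of "pairing X Y e" "pairing X Y f"] assms
    by (simp add: orth_iff add_mset_commute)
qed

lemma orth_triple:
  assumes "finite E" "X \<in> vecs F E" "Y \<in> vecs F E" "supp X \<inter> supp Y = {e, f, g}"
    "e \<noteq> f" "e \<noteq> g" "f \<noteq> g"
  shows "orth F \<sigma> E X Y \<longleftrightarrow> {#pairing X Y e, pairing X Y f, pairing X Y g#} \<in> nullset F"
  using assms by (simp add: orth_iff add_mset_commute)

text \<open>Orthogonality to an \<open>X\<close> meeting the common support in \<open>{e, f}\<close>
  determines the ratio of the entries at \<open>e\<close> and \<open>f\<close>. Hence
  \<open>Y\<close> and \<open>Z\<close> have the same ratios, and the scalar can be read off at one
  fixed element.\<close>

lemma scalar_multiple_if_orth:
  assumes fin: "finite E" and Y: "Y \<in> vecs F E" "Z \<in> vecs F E" "supp Y = supp Z"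
    and ne: "supp Z \<noteq> {}"
    and ex: "\<And>e f. \<lbrakk>e \<in> supp Z; f \<in> supp Z; e \<noteq> f\<rbrakk> \<Longrightarrow>
      \<exists>X\<in>vecs F E. supp X \<inter> supp Z = {e, f} \<and> orth F \<sigma> E X Y \<and> orth F \<sigma> E X Z"
  shows "\<exists>\<alpha>\<in>carrier F. Y = scale F \<alpha> Z"
proof -
  obtain e where e: "e \<in> supp Z" using ne by blast
  then have [simp]: "the (Y e) \<in> carrier F" "the (Z e) \<in> carrier F" using Y by auto
  let ?\<alpha> = "the (Y e) \<otimes> inv (the (Z e))"
  have "the (Y f) = ?\<alpha> \<otimes> the (Z f)" if f: "f \<in> supp Z" for f
  proof (cases "f = e")
    case True
    then show ?thesis by (simp add: m_assoc)
  next
    case False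
    have [simp]: "the (Y f) \<in> carrier F" "the (Z f) \<in> carrier F" using Y f by auto
    obtain X where X: "X \<in> vecs F E" "supp X \<inter> supp Z = {e, f}"
      "orth F \<sigma> E X Y" "orth F \<sigma> E X Z"
      using ex[OF e f] False by auto
    have "e \<in> supp X" "f \<in> supp X" using X(2) by auto
    then have [simp]: "the (X e) \<in> carrier F" "the (X f) \<in> carrier F" using X(1) by auto
    have "the (X e) \<otimes> \<sigma> (the (Y e)) = eps \<otimes> (the (X f) \<otimes> \<sigma> (the (Y f)))"
      using orth_pair[OF fin X(1) Y(1)] X(2,3) Y(3) False unfolding pairing_def by auto
    moreover have "the (X e) \<otimes> \<sigma> (the (Z e)) = eps \<otimes> (the (X f) \<otimes> \<sigma> (the (Z f)))"
      using orth_pair[OF fin X(1) Y(2) X(2)] X(4) False unfolding pairing_def by auto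
    \<comment> \<open>Cross-multiplying the two relations turns the entries of \<open>X\<close> into
      a common factor, which then cancels.\<close>
    ultimately have "(the (X e) \<otimes> \<sigma> (the (Y e))) \<otimes> (eps \<otimes> (the (X f) \<otimes> \<sigma> (the (Z f)))) =
      (eps \<otimes> (the (X f) \<otimes> \<sigma> (the (Y f)))) \<otimes> (the (X e) \<otimes> \<sigma> (the (Z e)))"
      by simp
    then have "(the (X e) \<otimes> eps \<otimes> the (X f)) \<otimes> (\<sigma> (the (Y e)) \<otimes> \<sigma> (the (Z f))) =
      (the (X e) \<otimes> eps \<otimes> the (X f)) \<otimes> (\<sigma> (the (Z e)) \<otimes> \<sigma> (the (Y f)))"
      by (simp add: m_ac)
    then have "\<sigma> (the (Y e)) \<otimes> \<sigma> (the (Z f)) = \<sigma> (the (Z e)) \<otimes> \<sigma> (the (Y f))"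
      by simp
    then have "\<sigma> (the (Y e) \<otimes> the (Z f)) = \<sigma> (the (Z e) \<otimes> the (Y f))"
      by (simp add: sigma_mult)
    then have "the (Y e) \<otimes> the (Z f) = the (Z e) \<otimes> the (Y f)"
      using sigma_inj by simp
    then have "the (Y f) = inv (the (Z e)) \<otimes> (the (Y e) \<otimes> the (Z f))"
      by (simp add: m_assoc[symmetric])
    also have "\<dots> = ?\<alpha> \<otimes> the (Z f)"
      by (simp add: m_ac)
    finally show ?thesis .
  qed
  then have "Y = scale F ?\<alpha> Z"
    using scale_eqI[OF Y(3)] by blast
  moreover have "?\<alpha> \<in> carrier F" by simp
  ultimately show ?thesis by blast
qed

text \<open>Surjectivity and injectivity of the bijection in \<open>tract_signature\<close>, moved
  from scalar classes to vectors. For this \<open>scalar_rel\<close> is shown to be an equivalence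
  relation, so that each vector lies in its own class and equal classes mean proportional
  vectors.\<close>

lemma
  assumes "tract_signature F N C"
  shows signature_supp: "supp ` C = circuits N"
    and signature_unique: "\<lbrakk>X \<in> C; Y \<in> C; supp X = supp Y\<rbrakk> \<Longrightarrow> \<exists>\<alpha>\<in>carrier F. X = scale F \<alpha> Y"
proof -
  have vecs: "C \<subseteq> vecs F (ground N)"
    and bij: "bij_betw (\<lambda>K. the_elem (supp ` K)) (C // scalar_rel F C) (circuits N)"
    using assms unfolding tract_signature_def by auto
  have equiv: "equiv C (scalar_rel F C)"
  proof (rule equivI)
    show "scalar_rel F C \<subseteq> C \<times> C"
      unfolding scalar_rel_def by auto
    show "refl_on C (scalar_rel F C)"
    proof (rule refl_onI)
      fix X assume X: "X \<in> C"
      then have "X = scale F \<one> X"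
        using scale_one vecs by (metis subsetD)
      with X show "(X, X) \<in> scalar_rel F C"
        unfolding scalar_rel_def using one_closed by blast
    qed
    show "sym (scalar_rel F C)"
    proof (rule symI)
      fix X Y assume "(X, Y) \<in> scalar_rel F C"
      then obtain \<alpha> where \<alpha>: "X \<in> C" "Y \<in> C" "\<alpha> \<in> carrier F" "X = scale F \<alpha> Y"
        unfolding scalar_rel_def by auto
      have "Y \<in> vecs F (ground N)"
        using \<alpha>(2) vecs by blast
      then have "scale F (inv \<alpha>) X = Y"
        using scale_scale[of "inv \<alpha>" \<alpha> Y] scale_one[of Y] \<alpha>(3) by (simp add: \<alpha>(4))
      moreover have "inv \<alpha> \<in> carrier F"
        using \<alpha>(3) by simp
      ultimately show "(Y, X) \<in> scalar_rel F C"
        unfolding scalar_rel_def using \<alpha>(1,2) by blast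
    qed
    show "trans (scalar_rel F C)"
    proof (rule transI)
      fix X Y Z assume "(X, Y) \<in> scalar_rel F C" "(Y, Z) \<in> scalar_rel F C"
      then obtain \<alpha> \<beta> where "X \<in> C" "Z \<in> C" "\<alpha> \<in> carrier F" "\<beta> \<in> carrier F"
        "X = scale F \<alpha> (scale F \<beta> Z)"
        unfolding scalar_rel_def by auto
      moreover from this have "scale F \<alpha> (scale F \<beta> Z) = scale F (\<alpha> \<otimes> \<beta>) Z"
        using scale_scale vecs by blast
      ultimately show "(X, Z) \<in> scalar_rel F C"
        unfolding scalar_rel_def using m_closed[of \<alpha> \<beta>] by auto
    qed
  qed
  have elem: "the_elem (supp ` (scalar_rel F C `` {X})) = supp X" if "X \<in> C" for X
  proof -
    have "supp X \<in> supp ` (scalar_rel F C `` {X})"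
      using equiv_class_self[OF equiv that] by (rule imageI)
    moreover have "supp ` (scalar_rel F C `` {X}) \<subseteq> {supp X}"
      unfolding scalar_rel_def by auto
    ultimately have "supp ` (scalar_rel F C `` {X}) = {supp X}"
      by blast
    then show ?thesis by simp
  qed
  have "circuits N = (\<lambda>K. the_elem (supp ` K)) ` (C // scalar_rel F C)"
    using bij unfolding bij_betw_def by simp
  also have "C // scalar_rel F C = (\<lambda>X. scalar_rel F C `` {X}) ` C"
    unfolding quotient_def by blast
  also have "(\<lambda>K. the_elem (supp ` K)) ` \<dots> = supp ` C"
    unfolding image_image using elem by (rule image_cong[OF refl])
  finally show "supp ` C = circuits N" by simp
  assume XY: "X \<in> C" "Y \<in> C" "supp X = supp Y"
  have "scalar_rel F C `` {X} = scalar_rel F C `` {Y}"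
    by (rule inj_onD[OF bij_betw_imp_inj_on[OF bij]])
      (simp_all only: elem[OF XY(1)] elem[OF XY(2)] XY(3) quotientI[OF XY(1)] quotientI[OF XY(2)])
  then have "(X, Y) \<in> scalar_rel F C"
    using eq_equiv_class[OF _ equiv XY(2)] by simp
  then show "\<exists>\<alpha>\<in>carrier F. X = scale F \<alpha> Y"
    unfolding scalar_rel_def by auto
qed

end

section \<open>Dual pairs of signatures\<close>

locale dual_signatures = involutive_tract F \<sigma> + matroid M
  for F :: "'g tract" (structure) and \<sigma> and M :: "'e set_system" +
  fixes C D :: "('e \<Rightarrow> 'g option) set"
  assumes signature_C: "tract_signature F M C"
    and signature_D: "tract_signature F (dual M) D"
begin

section \<open>Vectors supported on circuits and cocircuits\<close>

abbreviation "E \<equiv> ground M"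

lemma C_vecs: "X \<in> C \<Longrightarrow> X \<in> vecs F E"
  using signature_C unfolding tract_signature_def by blast

lemma D_vecs: "Y \<in> D \<Longrightarrow> Y \<in> vecs F E"
  using signature_D unfolding tract_signature_def by auto

lemma C_scale: "\<lbrakk>X \<in> C; \<alpha> \<in> carrier F\<rbrakk> \<Longrightarrow> scale F \<alpha> X \<in> C"
  using signature_C unfolding tract_signature_def by blast

lemma C_circuit: "X \<in> C \<Longrightarrow> supp X \<in> circuits M"
  unfolding signature_supp[OF signature_C, symmetric] by (rule imageI)

lemma D_cocircuit: "Y \<in> D \<Longrightarrow> supp Y \<in> circuits (dual M)"
  unfolding signature_supp[OF signature_D, symmetric] by (rule imageI)

lemma circuit_C:
  assumes "S \<in> circuits M"
  obtains X where "X \<in> C" "supp X = S"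
  using assms that unfolding signature_supp[OF signature_C, symmetric] by (metis imageE)

lemma cocircuit_D:
  assumes "T \<in> circuits (dual M)"
  obtains Y where "Y \<in> D" "supp Y = T"
  using assms that unfolding signature_supp[OF signature_D, symmetric] by (metis imageE)

lemma inter_not_single: "\<lbrakk>X \<in> C; Y \<in> D\<rbrakk> \<Longrightarrow> supp X \<inter> supp Y \<noteq> {e}"
  using circuit_cocircuit_inter[OF C_circuit D_cocircuit] .

text \<open>A coindependent support would meet some circuit in a single element, and orthogonality
  to a vector on that circuit would make a one-term sum null.\<close>

lemma perp2_supp_codependent:
  assumes "Y \<in> perp2 F \<sigma> E C" "Y \<noteq> zero_vec"
  shows "supp Y \<notin> indeps (dual M)"
proof
  assume dep: "supp Y \<in> indeps (dual M)"
  obtain e where "e \<in> supp Y"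
    using assms(2) supp_eq_empty by blast
  from coindependent_circuit_inter[OF dep this] obtain S
    where S: "S \<in> circuits M" "S \<inter> supp Y = {e}" .
  from circuit_C[OF S(1)] obtain X where X: "X \<in> C" "supp X = S" .
  have "card (supp X \<inter> supp Y) \<le> 2"
    unfolding X(2) S(2) by simp
  then have "orth F \<sigma> E X Y"
    using assms(1) X(1) unfolding perp2_def by blast
  moreover have "Y \<in> vecs F E"
    using assms(1) unfolding perp2_def by blast
  ultimately show False
    using orth_single[OF finite_ground C_vecs[OF X(1)]] X(2) S(2) by blast
qed

text \<open>Every nonzero vector in \<open>perp2\<close> has a cocircuit inside its support, so the
  minimal supports are those of \<open>D\<close>. On such a support, orthogonality to circuits
  meeting it in two elements fixes the vector up to a scalar.\<close>

lemma cocircuits_eq: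
  assumes "D \<subseteq> perp2 F \<sigma> E C"
  shows "D = tract_cocircuits F \<sigma> E C"
proof -
  have below: "\<exists>Z\<in>D. supp Z \<subseteq> supp Y" if Y: "Y \<in> perp2 F \<sigma> E C" "Y \<noteq> zero_vec" for Y
  proof -
    have "Y \<in> vecs F E"
      using Y(1) unfolding perp2_def by blast
    then have "finite (ground (dual M))" "supp Y \<subseteq> ground (dual M)"
      using supp_subset finite_ground by auto
    from contains_circuit[OF this perp2_supp_codependent[OF Y]] obtain T
      where T: "T \<in> circuits (dual M)" "T \<subseteq> supp Y" .
    from cocircuit_D[OF T(1)] obtain Z where "Z \<in> D" "supp Z = T" .
    with T(2) show ?thesis by blast
  qed
  have nz: "Y \<noteq> zero_vec" if "Y \<in> D" for Y
    using that signature_D unfolding tract_signature_def by blast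
  show ?thesis
  proof
    show "D \<subseteq> tract_cocircuits F \<sigma> E C"
    proof
      fix Y assume Y: "Y \<in> D"
      have "\<not> supp Y' \<subset> supp Y" if Y': "Y' \<in> perp2 F \<sigma> E C - {zero_vec}" for Y'
      proof
        assume less: "supp Y' \<subset> supp Y"
        obtain Z where "Z \<in> D" "supp Z \<subseteq> supp Y'"
          using below Y' by blast
        with circuit_subset_eq[of "supp Z" "dual M" "supp Y"] D_cocircuit Y less
        show False by blast
      qed
      then show "Y \<in> tract_cocircuits F \<sigma> E C"
        using Y assms nz unfolding tract_cocircuits_def by blast
    qed
  next
    show "tract_cocircuits F \<sigma> E C \<subseteq> D"
    proof
      fix Y assume "Y \<in> tract_cocircuits F \<sigma> E C"
      then have Y: "Y \<in> perp2 F \<sigma> E C" "Y \<noteq> zero_vec"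
        and min: "\<And>Y'. \<lbrakk>Y' \<in> perp2 F \<sigma> E C; Y' \<noteq> zero_vec\<rbrakk> \<Longrightarrow> \<not> supp Y' \<subset> supp Y"
        unfolding tract_cocircuits_def by blast+
      obtain Z where Z: "Z \<in> D" "supp Z \<subseteq> supp Y"
        using below[OF Y] by blast
      then have ZY: "supp Y = supp Z"
        using min[of Z] assms nz by blast
      have Yv: "Y \<in> vecs F E"
        using Y(1) unfolding perp2_def by blast
      have ne: "supp Z \<noteq> {}"
        using Y(2) supp_eq_empty[of Y] ZY by simp
      have "\<exists>\<alpha>\<in>carrier F. Y = scale F \<alpha> Z"
      proof (rule scalar_multiple_if_orth[OF finite_ground Yv D_vecs[OF Z(1)] ZY ne])
        fix e f assume ef: "e \<in> supp Z" "f \<in> supp Z" "e \<noteq> f"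
        from cocircuit_two_circuit[OF D_cocircuit[OF Z(1)] ef] obtain S
          where S: "S \<in> circuits M" "S \<inter> supp Z = {e, f}" .
        from circuit_C[OF S(1)] obtain X where X: "X \<in> C" "supp X = S" .
        have "card (supp X \<inter> supp Z) \<le> 2"
          unfolding X(2) S(2) using ef(3) by simp
        then have "orth F \<sigma> E X Y" "orth F \<sigma> E X Z"
          using Y(1) Z(1) assms X(1) ZY unfolding perp2_def by auto
        then show "\<exists>X\<in>vecs F E. supp X \<inter> supp Z = {e, f} \<and> orth F \<sigma> E X Y \<and> orth F \<sigma> E X Z"
          using C_vecs X S(2) by blast
      qed
      then show "Y \<in> D"
        using Z(1) signature_D unfolding tract_signature_def by blast
    qed
  qed
qed

section \<open>Modular pairs of circuits\<close>

lemma modular_pair_cover: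
  assumes "modular_pair C X Y" "S \<in> circuits M" "T \<in> circuits M" "S \<noteq> T"
    "S \<union> T \<subseteq> supp X \<union> supp Y"
  shows "S \<union> T = supp X \<union> supp Y"
proof (rule ccontr)
  assume "S \<union> T \<noteq> supp X \<union> supp Y"
  with assms(5) have less: "S \<union> T \<subset> supp X \<union> supp Y" by blast
  from circuit_C[OF assms(2)] obtain X' where "X' \<in> C" "supp X' = S" .
  moreover from circuit_C[OF assms(3)] obtain Y' where "Y' \<in> C" "supp Y' = T" .
  ultimately show False
    using assms(1,4) less unfolding modular_pair_def by metis
qed

text \<open>A circuit in the union avoiding \<open>g\<close> and \<open>q\<close> would differ from
  \<open>supp Y\<close>, and the two together would miss \<open>g\<close>, against modularity. So
  the union without \<open>g\<close> and \<open>q\<close> is independent and has a fundamental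
  cocircuit at \<open>b\<close>. The vector \<open>W\<close> serves to compare entries at
  \<open>b\<close> with entries at \<open>g\<close> and \<open>q\<close>.\<close>

lemma modular_pair_cocircuit:
  assumes mod: "modular_pair C X Y" and XY: "X \<in> C" "Y \<in> C"
    and g: "g \<in> supp X" "g \<notin> supp Y" and q: "q \<in> supp Y"
    and b: "b \<in> supp X \<union> supp Y" "b \<noteq> g" "b \<noteq> q"
  obtains W where "W \<in> D" "b \<in> supp W" "supp W \<inter> (supp X \<union> supp Y) \<subseteq> {b, g, q}"
proof -
  define A where "A = supp X \<union> supp Y"
  define I where "I = A - {g, q}"
  have "A \<subseteq> E"
    unfolding A_def using XY C_vecs supp_subset by blast
  then have IE: "I \<subseteq> E" unfolding I_def by blast
  have "I \<in> indeps M"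
  proof (rule ccontr)
    assume "I \<notin> indeps M"
    from contains_circuit[OF finite_ground IE this] obtain T
      where T: "T \<in> circuits M" "T \<subseteq> I" .
    then have "T \<noteq> supp Y" "T \<union> supp Y \<subseteq> supp X \<union> supp Y"
      using q unfolding I_def A_def by blast+
    from modular_pair_cover[OF mod T(1) C_circuit[OF XY(2)] this]
    show False using T(2) g unfolding I_def by blast
  qed
  moreover have "b \<in> I"
    using b unfolding I_def A_def by blast
  ultimately obtain T where T: "T \<in> circuits (dual M)" "T \<inter> I = {b}"
    by (rule fundamental_cocircuit)
  from cocircuit_D[OF T(1)] obtain W where W: "W \<in> D" "supp W = T" .
  have "T \<inter> A \<subseteq> T \<inter> I \<union> {g, q}"
    unfolding I_def by blast
  then have "supp W \<inter> A \<subseteq> {b, g, q}"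
    unfolding T(2) W(2) by auto
  moreover have "b \<in> supp W"
    using T(2) W(2) by auto
  ultimately show thesis
    using that[OF W(1)] unfolding A_def by simp
qed

section \<open>From orthogonality to modular elimination\<close>

context
  assumes orth3: "\<And>X Y. \<lbrakk>X \<in> C; Y \<in> D; card (supp X \<inter> supp Y) \<le> 3\<rbrakk> \<Longrightarrow> orth F \<sigma> E X Y"
begin

lemma pairing_pair:
  assumes "X \<in> C" "Y \<in> D" "supp X \<inter> supp Y = {e, f}" "e \<noteq> f"
  shows "pairing X Y e = eps \<otimes> pairing X Y f"
proof -
  have "card (supp X \<inter> supp Y) \<le> 3"
    unfolding assms(3) using assms(4) by simp
  from orth3[OF assms(1,2) this] show ?thesis
    using orth_pair[OF finite_ground C_vecs D_vecs assms(3,4)] assms(1,2) by blast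
qed

lemma pairing_triple:
  assumes "X \<in> C" "Y \<in> D" "supp X \<inter> supp Y = {e, f, g}" "e \<noteq> f" "e \<noteq> g" "f \<noteq> g"
  shows "{#pairing X Y e, pairing X Y f, pairing X Y g#} \<in> nullset F"
proof -
  have "card (supp X \<inter> supp Y) \<le> 3"
    unfolding assms(3) using assms(4-6) by simp
  from orth3[OF assms(1,2) this] show ?thesis
    using orth_triple[OF finite_ground C_vecs D_vecs assms(3-6)] assms(1,2) by blast
qed

lemma modular_elimination:
  assumes mod: "modular_pair C X Y" and XY: "X \<in> C" "Y \<in> C"
    and e: "e \<in> supp X" "e \<in> supp Y" and neg: "the (X e) = eps \<otimes> the (Y e)"
  shows "\<exists>Z\<in>C. Z e = None \<and>
    (\<forall>f\<in>E. formal (X f) + formal (Y f) + formal (tneg F (Z f)) \<in> nullset F)"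
proof -
  let ?A = "supp X \<union> supp Y"
  have SXY: "supp X \<in> circuits M" "supp Y \<in> circuits M" "supp X \<noteq> supp Y"
    using XY C_circuit mod unfolding modular_pair_def by blast+
  obtain g where g: "g \<in> supp X" "g \<notin> supp Y"
    using circuit_subset_eq[OF SXY(1,2)] SXY(3) by blast
  obtain h where h: "h \<in> supp Y" "h \<notin> supp X"
    using circuit_subset_eq[OF SXY(2,1)] SXY(3) by blast
  \<comment> \<open>\<open>S\<close> will be the support of \<open>Z\<close>. By modularity it
    covers \<open>?A\<close> together with either of the two given supports.\<close>
  from circuit_elimination[OF SXY e(1)] obtain S
    where S: "S \<in> circuits M" "S \<subseteq> ?A - {e}" .
  have SX: "S \<union> supp X = ?A"
    by (rule modular_pair_cover[OF mod S(1) SXY(1)]) (use S(2) e in blast)+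
  have SY: "S \<union> supp Y = ?A"
    by (rule modular_pair_cover[OF mod S(1) SXY(2)]) (use S(2) e in blast)+
  have gS: "g \<in> S" using SY g by blast
  from circuit_C[OF S(1)] obtain Z\<^sub>0 where Z\<^sub>0: "Z\<^sub>0 \<in> C" "supp Z\<^sub>0 = S" .
  have cl: "the (X g) \<in> carrier F" "the (Z\<^sub>0 g) \<in> carrier F"
    using g(1) gS Z\<^sub>0(2) the_closed[OF C_vecs[OF XY(1)]] the_closed[OF C_vecs[OF Z\<^sub>0(1)]] by auto
  \<comment> \<open>The scaling is forced: \<open>g\<close> lies outside \<open>supp Y\<close>, so
    elimination requires \<open>Z\<close> to agree with \<open>X\<close> there.\<close>
  define Z where "Z = scale F (the (X g) \<otimes> inv (the (Z\<^sub>0 g))) Z\<^sub>0"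
  have Z: "Z \<in> C" "supp Z = S"
    using Z\<^sub>0 cl unfolding Z_def by (simp_all add: C_scale)
  have Zg: "the (Z g) = the (X g)"
    using gS Z\<^sub>0(2) cl unfolding Z_def by (simp add: the_scale m_assoc)
  have xcl: "\<And>i. i \<in> supp X \<Longrightarrow> the (X i) \<in> carrier F"
    and ycl: "\<And>i. i \<in> supp Y \<Longrightarrow> the (Y i) \<in> carrier F"
    and zcl: "\<And>i. i \<in> S \<Longrightarrow> the (Z i) \<in> carrier F"
    using the_closed[OF C_vecs] XY Z by blast+
  have ne: "e \<noteq> g" "e \<noteq> h" "g \<noteq> h" using e g h by blast+
  have eS: "e \<notin> S" using S(2) by blast
  have wcl: "\<sigma> (the (W i)) \<in> carrier F" if "W \<in> D" "i \<in> supp W" for W i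
    using the_closed[OF D_vecs] that by simp
  \<comment> \<open>Here \<open>W\<close> cannot contain \<open>e\<close>, since it would meet
    \<open>supp Y\<close> only there. So \<open>W\<close> meets both \<open>supp X\<close> and
    \<open>supp Z\<close> in \<open>{f, g}\<close>, and the agreement at \<open>g\<close> carries
    over to \<open>f\<close>.\<close>
  have ZX: "the (Z f) = the (X f)" if f: "f \<in> supp X" "f \<notin> supp Y" for f
  proof (cases "f = g")
    case False
    have fS: "f \<in> S" using SY f by blast
    have fe: "f \<noteq> e" using f e by blast
    obtain W where W: "W \<in> D" "f \<in> supp W" "supp W \<inter> ?A \<subseteq> {f, g, e}"
      using modular_pair_cocircuit[OF mod XY g e(2) _ False fe] f(1) by blast
    have "e \<notin> supp W"
    proof
      assume "e \<in> supp W"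
      then have "supp Y \<inter> supp W = {e}"
        using W(3) e f(2) g(2) by blast
      then show False using inter_not_single[OF XY(2) W(1)] by blast
    qed
    then have WA: "supp W \<inter> ?A \<subseteq> {f, g}" using W(3) by blast
    have gW: "g \<in> supp W"
    proof (rule ccontr)
      assume "g \<notin> supp W"
      then have "supp X \<inter> supp W = {f}"
        using WA W(2) f(1) by blast
      then show False using inter_not_single[OF XY(1) W(1)] by blast
    qed
    have "supp X \<inter> supp W = {f, g}" "supp Z \<inter> supp W = {f, g}"
      using WA W(2) gW f(1) g(1) fS gS S(2) Z(2) by blast+
    with pairing_pair[OF XY(1) W(1) _ False] pairing_pair[OF Z(1) W(1) _ False]
    have "the (X f) \<otimes> \<sigma> (the (W f)) = the (Z f) \<otimes> \<sigma> (the (W f))"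
      unfolding pairing_def by (simp add: Zg)
    then show ?thesis
      using xcl[OF f(1)] zcl[OF fS] wcl[OF W(1,2)] by simp
  qed (simp add: Zg)
  \<comment> \<open>Now \<open>W\<close> meets the supports of \<open>Z\<close>, \<open>X\<close>
    and \<open>Y\<close> in \<open>{f, g}\<close>, \<open>{g, e}\<close> and \<open>{f, e}\<close>.
    Going from \<open>f\<close> through \<open>g\<close> and \<open>e\<close> back to
    \<open>f\<close>, the three signs and the one in \<open>neg\<close> cancel.\<close>
  have ZY: "the (Z f) = the (Y f)" if f: "f \<in> supp Y" "f \<notin> supp X" for f
  proof -
    have fS: "f \<in> S" using SX f by blast
    have fe: "f \<noteq> e" "f \<noteq> g" using f e g by blast+
    obtain W where W: "W \<in> D" "f \<in> supp W" "supp W \<inter> ?A \<subseteq> {f, g, e}"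
      using modular_pair_cocircuit[OF mod XY g e(2) _ fe(2,1)] f(1) by blast
    have eW: "e \<in> supp W"
    proof (rule ccontr)
      assume "e \<notin> supp W"
      then have "supp Y \<inter> supp W = {f}"
        using W(2,3) f(1) g(2) by blast
      then show False using inter_not_single[OF XY(2) W(1)] by blast
    qed
    have gW: "g \<in> supp W"
    proof (rule ccontr)
      assume "g \<notin> supp W"
      then have "supp X \<inter> supp W = {e}"
        using W(3) eW e(1) f(2) by blast
      then show False using inter_not_single[OF XY(1) W(1)] by blast
    qed
    have int: "supp X \<inter> supp W = {g, e}" "supp Y \<inter> supp W = {f, e}" "supp Z \<inter> supp W = {f, g}"
      using W(2,3) eW gW f e g fS gS eS S(2) Z(2) by blast+
    let ?we = "\<sigma> (the (W e))" and ?wf = "\<sigma> (the (W f))" and ?wg = "\<sigma> (the (W g))"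
    note [simp] = wcl[OF W(1,2)] wcl[OF W(1) eW] wcl[OF W(1) gW]
      ycl[OF e(2)] xcl[OF g(1)] ycl[OF f(1)] zcl[OF fS]
    have "the (Z f) \<otimes> ?wf = eps \<otimes> (the (X g) \<otimes> ?wg)"
      using pairing_pair[OF Z(1) W(1) int(3) fe(2)] unfolding pairing_def Zg .
    also have "the (X g) \<otimes> ?wg = eps \<otimes> (the (X e) \<otimes> ?we)"
      using pairing_pair[OF XY(1) W(1) int(1)] ne(1) unfolding pairing_def by blast
    also have "eps \<otimes> (eps \<otimes> (the (X e) \<otimes> ?we)) = eps \<otimes> (the (Y e) \<otimes> ?we)"
      unfolding neg by (simp add: eps_eps_mult m_assoc)
    also have "\<dots> = the (Y f) \<otimes> ?wf"
      using pairing_pair[OF XY(2) W(1) int(2) fe(1)] unfolding pairing_def by simp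
    finally show ?thesis by simp
  qed
  \<comment> \<open>Here \<open>W\<close> cannot contain \<open>g\<close>, since it would meet
    \<open>supp Z\<close> only there. Both \<open>X\<close> and \<open>Y\<close> then compare
    \<open>f\<close> with \<open>e\<close>, and the opposite signs at \<open>e\<close> reappear at
    \<open>f\<close>.\<close>
  have XeY: "the (X f) = eps \<otimes> the (Y f)" if f: "f \<in> supp X" "f \<in> supp Y" "f \<notin> S" for f
  proof (cases "f = e")
    case False
    have fg: "f \<noteq> g" using f g by blast
    obtain W where W: "W \<in> D" "f \<in> supp W" "supp W \<inter> ?A \<subseteq> {f, g, e}"
      using modular_pair_cocircuit[OF mod XY g e(2) _ fg False] f(1) by blast
    have gW: "g \<notin> supp W"
    proof
      assume "g \<in> supp W"
      then have "supp Z \<inter> supp W = {g}"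
        using W(3) gS eS f(3) S(2) Z(2) by blast
      then show False using inter_not_single[OF Z(1) W(1)] by blast
    qed
    have eW: "e \<in> supp W"
    proof (rule ccontr)
      assume "e \<notin> supp W"
      then have "supp X \<inter> supp W = {f}"
        using W(2,3) gW f(1) by blast
      then show False using inter_not_single[OF XY(1) W(1)] by blast
    qed
    have int: "supp X \<inter> supp W = {f, e}" "supp Y \<inter> supp W = {f, e}"
      using W(2,3) eW gW f e by blast+
    let ?we = "\<sigma> (the (W e))" and ?wf = "\<sigma> (the (W f))"
    note [simp] = wcl[OF W(1,2)] wcl[OF W(1) eW] ycl[OF e(2)] ycl[OF f(2)] xcl[OF f(1)]
    have "the (X f) \<otimes> ?wf = eps \<otimes> (the (X e) \<otimes> ?we)"
      using pairing_pair[OF XY(1) W(1) int(1) False] unfolding pairing_def .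
    also have "the (X e) \<otimes> ?we = eps \<otimes> (the (Y e) \<otimes> ?we)"
      unfolding neg by (simp add: m_assoc)
    also have "eps \<otimes> (the (Y e) \<otimes> ?we) = the (Y f) \<otimes> ?wf"
      using pairing_pair[OF XY(2) W(1) int(2) False] unfolding pairing_def by simp
    also have "eps \<otimes> (the (Y f) \<otimes> ?wf) = (eps \<otimes> the (Y f)) \<otimes> ?wf"
      by (simp add: m_assoc)
    finally show ?thesis by simp
  qed (use neg in simp)
  \<comment> \<open>With \<open>h\<close> in place of \<open>e\<close>, the vector \<open>W\<close>
    meets \<open>supp X\<close> in \<open>{g, f}\<close>, \<open>supp Y\<close> in
    \<open>{h, f}\<close> and \<open>supp Z\<close> in \<open>{f, g, h}\<close>. This is where a
    three-element intersection enters: the entries of \<open>Z\<close> at \<open>g\<close> and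
    \<open>h\<close> are those of \<open>X\<close> and \<open>Y\<close>, which the two-term
    relations move to \<open>f\<close>.\<close>
  have triple: "{#the (X f), the (Y f), eps \<otimes> the (Z f)#} \<in> nullset F"
    if f: "f \<in> supp X" "f \<in> supp Y" "f \<in> S" for f
  proof -
    have fg: "f \<noteq> g" "f \<noteq> h" using f g h by blast+
    have hS: "h \<in> S" using SX h by blast
    obtain W where W: "W \<in> D" "f \<in> supp W" "supp W \<inter> ?A \<subseteq> {f, g, h}"
      using modular_pair_cocircuit[OF mod XY g h(1) _ fg] f(1) by blast
    have gW: "g \<in> supp W"
    proof (rule ccontr)
      assume "g \<notin> supp W"
      then have "supp X \<inter> supp W = {f}"
        using W(2,3) h(2) f(1) by blast
      then show False using inter_not_single[OF XY(1) W(1)] by blast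
    qed
    have hW: "h \<in> supp W"
    proof (rule ccontr)
      assume "h \<notin> supp W"
      then have "supp Y \<inter> supp W = {f}"
        using W(2,3) g(2) f(2) by blast
      then show False using inter_not_single[OF XY(2) W(1)] by blast
    qed
    have int: "supp X \<inter> supp W = {g, f}" "supp Y \<inter> supp W = {h, f}"
      "supp Z \<inter> supp W = {f, g, h}"
      using W(2,3) gW hW f g h gS hS S(2) Z(2) by blast+
    let ?wf = "\<sigma> (the (W f))" and ?wg = "\<sigma> (the (W g))" and ?wh = "\<sigma> (the (W h))"
    note [simp] = wcl[OF W(1,2)] wcl[OF W(1) gW] wcl[OF W(1) hW]
      xcl[OF f(1)] ycl[OF f(2)] zcl[OF f(3)]
    have "the (X g) \<otimes> ?wg = eps \<otimes> (the (X f) \<otimes> ?wf)"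
      using pairing_pair[OF XY(1) W(1) int(1)] fg unfolding pairing_def by blast
    moreover have "the (Y h) \<otimes> ?wh = eps \<otimes> (the (Y f) \<otimes> ?wf)"
      using pairing_pair[OF XY(2) W(1) int(2)] fg unfolding pairing_def by blast
    moreover have "{#the (Z f) \<otimes> ?wf, the (X g) \<otimes> ?wg, the (Y h) \<otimes> ?wh#} \<in> nullset F"
      using pairing_triple[OF Z(1) W(1) int(3) fg ne(3)]
      unfolding pairing_def Zg ZY[OF h] .
    ultimately have "{#the (Z f) \<otimes> ?wf, eps \<otimes> (the (X f) \<otimes> ?wf), eps \<otimes> (the (Y f) \<otimes> ?wf)#}
        \<in> nullset F"
      by simp
    then show ?thesis
      using null_triple_neg[of "the (X f)" "the (Y f)" "the (Z f)" ?wf]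
      by (simp add: add_mset_commute)
  qed
  have "formal (X f) + formal (Y f) + formal (tneg F (Z f)) \<in> nullset F" if "f \<in> E" for f
  proof -
    have [simp]: "formal (V f) = {#the (V f)#}" "formal (tneg F (V f)) = {#eps \<otimes> the (V f)#}"
      if "f \<in> supp V" for V
      using that by (auto simp: supp_def formal_def tneg_def tmult_def)
    have [simp]: "formal (V f) = {#}" "formal (tneg F (V f)) = {#}" if "f \<notin> supp V" for V
      using eq_None[OF that] by (simp_all add: formal_def tneg_def tmult_def)
    \<comment> \<open>By \<open>SX\<close> and \<open>SY\<close> an element of exactly one of the
      two supports lies in \<open>S\<close>, so only the elements common to both need a distinction
      by \<open>S\<close>.\<close>
    consider "f \<notin> ?A" | "f \<in> supp X" "f \<notin> supp Y" | "f \<in> supp Y" "f \<notin> supp X"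
      | "f \<in> supp X" "f \<in> supp Y" "f \<notin> S" | "f \<in> supp X" "f \<in> supp Y" "f \<in> S"
      by blast
    then show ?thesis
    proof cases
      case 1
      then have "f \<notin> supp Z" using S(2) Z(2) by blast
      with 1 show ?thesis by (simp add: T0)
    next
      case 2
      then have "f \<in> supp Z" using SY Z(2) by blast
      with 2 show ?thesis
        using null_pair[of "the (X f)" "eps \<otimes> the (X f)"] xcl[of f]
        by (simp add: ZX eps_eps_mult add_mset_commute)
    next
      case 3
      then have "f \<in> supp Z" using SX Z(2) by blast
      with 3 show ?thesis
        using null_pair[of "the (Y f)" "eps \<otimes> the (Y f)"] ycl[of f]
        by (simp add: ZY eps_eps_mult add_mset_commute)
    next
      case 4
      then show ?thesis
        using null_pair[of "the (X f)" "the (Y f)"] XeY[OF 4] xcl[of f] ycl[of f]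
        by (simp add: Z(2) add_mset_commute)
    next
      case 5
      then show ?thesis
        using triple[OF 5] by (simp add: Z(2) add_mset_commute)
    qed
  qed
  moreover have "Z e = None"
    using eq_None[of e Z] eS Z(2) by simp
  ultimately show ?thesis using Z(1) by blast
qed

text \<open>(C0) and (C1) come with the signature. (C2) holds because circuits are incomparable and
  vectors on the same circuit are proportional.\<close>

lemma weak_tract_matroid_if_orth: "weak_tract_matroid F E C"
  unfolding weak_tract_matroid_def
proof (intro conjI ballI impI)
  show "C \<subseteq> vecs F E" using C_vecs by blast
  show "zero_vec \<notin> C"
    using signature_C unfolding tract_signature_def by blast
  show "scale F \<alpha> X \<in> C" if "\<alpha> \<in> carrier F" "X \<in> C" for \<alpha> X
    using C_scale that by blast
  show "\<exists>\<alpha>\<in>carrier F. X = scale F \<alpha> Y" if "X \<in> C" "Y \<in> C" "supp X \<subseteq> supp Y" for X Y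
    using signature_unique[OF signature_C that(1,2)]
      circuit_subset_eq[OF C_circuit C_circuit] that by blast
  fix X Y e
  assume XY: "X \<in> C" "Y \<in> C"
    and "modular_pair C X Y \<and> X e = tneg F (Y e) \<and> X e \<noteq> None"
  then have H: "modular_pair C X Y" "X e = tneg F (Y e)" "X e \<noteq> None" by blast+
  then obtain y where "Y e = Some y"
    by (cases "Y e") (simp_all add: tneg_def tmult_def)
  with H(2) have "e \<in> supp X" "e \<in> supp Y" "the (X e) = eps \<otimes> the (Y e)"
    by (simp_all add: supp_def tneg_def tmult_def)
  from modular_elimination[OF H(1) XY this]
  show "\<exists>Z\<in>C. Z e = None \<and>
    (\<forall>f\<in>E. formal (X f) + formal (Y f) + formal (tneg F (Z f)) \<in> nullset F)" .
qed

lemma cocircuits_eq_if_orth: "D = tract_cocircuits F \<sigma> E C"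
proof (rule cocircuits_eq)
  show "D \<subseteq> perp2 F \<sigma> E C"
    unfolding perp2_def using D_vecs orth3 by fastforce
qed

end

section \<open>From modular elimination to orthogonality\<close>

lemma orth_if_weak_tract_matroid:
  assumes weak: "weak_tract_matroid F E C" and D: "D = tract_cocircuits F \<sigma> E C"
    and XY: "X \<in> C" "Y \<in> D" and card: "card (supp X \<inter> supp Y) \<le> 3"
  shows "orth F \<sigma> E X Y"
proof -
  have perp: "orth F \<sigma> E V Y" if "V \<in> C" "card (supp V \<inter> supp Y) \<le> 2" for V
  proof -
    have "Y \<in> perp2 F \<sigma> E C"
      using XY(2) unfolding D tract_cocircuits_def by blast
    with that show ?thesis
      unfolding perp2_def by blast
  qed
  show ?thesis
  proof (cases "card (supp X \<inter> supp Y) \<le> 2")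
    case False
    with card have "card (supp X \<inter> supp Y) = 3" by simp
    then obtain e f g where int: "supp X \<inter> supp Y = {e, f, g}"
      and ne: "e \<noteq> f" "e \<noteq> g" "f \<noteq> g"
      unfolding card_3_iff by metis
    from circuit_cocircuit_three[OF C_circuit[OF XY(1)] D_cocircuit[OF XY(2)] int ne]
    obtain S\<^sub>1 S\<^sub>2 h where S: "S\<^sub>1 \<in> circuits M" "S\<^sub>2 \<in> circuits M"
      and S1: "S\<^sub>1 \<inter> supp Y = {e, g}" and S2: "S\<^sub>2 \<inter> supp Y = {f, g}"
      and h: "h \<in> S\<^sub>1" "h \<in> S\<^sub>2"
      and mod: "\<And>R R'. \<lbrakk>R \<in> circuits M; R' \<in> circuits M; R \<union> R' \<subset> S\<^sub>1 \<union> S\<^sub>2\<rbrakk> \<Longrightarrow> R = R'"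
      and uniq: "\<And>R. \<lbrakk>R \<in> circuits M; R \<subseteq> S\<^sub>1 \<union> S\<^sub>2 - {h}\<rbrakk> \<Longrightarrow> R = supp X"
      by blast
    from circuit_C[OF S(1)] obtain X\<^sub>0 where X0: "X\<^sub>0 \<in> C" "supp X\<^sub>0 = S\<^sub>1" .
    from circuit_C[OF S(2)] obtain X\<^sub>2 where X2: "X\<^sub>2 \<in> C" "supp X\<^sub>2 = S\<^sub>2" .
    have cl: "the (X\<^sub>0 h) \<in> carrier F" "the (X\<^sub>2 h) \<in> carrier F"
      using the_closed[OF C_vecs] X0 X2 h by blast+
    \<comment> \<open>Scaled so that \<open>X\<^sub>1\<close> and \<open>X\<^sub>2\<close> have
      opposite entries at \<open>h\<close>, as (C3)' demands for eliminating
      \<open>h\<close>.\<close>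
    define X\<^sub>1 where "X\<^sub>1 = scale F (eps \<otimes> the (X\<^sub>2 h) \<otimes> inv (the (X\<^sub>0 h))) X\<^sub>0"
    have X1: "X\<^sub>1 \<in> C" "supp X\<^sub>1 = S\<^sub>1"
      using X0 cl unfolding X\<^sub>1_def by (simp_all add: C_scale)
    have "the (X\<^sub>1 h) = eps \<otimes> the (X\<^sub>2 h)"
      using h X0(2) cl unfolding X\<^sub>1_def by (simp add: the_scale m_assoc)
    moreover obtain x\<^sub>1 x\<^sub>2 where "X\<^sub>1 h = Some x\<^sub>1" "X\<^sub>2 h = Some x\<^sub>2"
      using h X1(2) X2(2) eq_Some_the[of h X\<^sub>1] eq_Some_the[of h X\<^sub>2] by simp
    ultimately have neg: "X\<^sub>1 h = tneg F (X\<^sub>2 h)" "X\<^sub>1 h \<noteq> None"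
      unfolding tneg_def tmult_def by simp_all
    have mem: "e \<in> S\<^sub>1" "e \<notin> S\<^sub>2" "f \<in> S\<^sub>2" "f \<notin> S\<^sub>1" "g \<in> S\<^sub>1" "g \<in> S\<^sub>2"
      "e \<in> supp X" "f \<in> supp X" "g \<in> supp X" "e \<in> supp Y" "f \<in> supp Y" "g \<in> supp Y"
      using S1 S2 int ne by auto
    have "modular_pair C X\<^sub>1 X\<^sub>2"
      unfolding modular_pair_def X1(2) X2(2) using mod mem(1,2) C_circuit by blast
    moreover have "h \<in> E"
      using S(1) h(1) unfolding circuits_def by blast
    ultimately obtain Z where Z: "Z \<in> C" "Z h = None"
      and null: "\<And>i. i \<in> E \<Longrightarrow> formal (X\<^sub>1 i) + formal (X\<^sub>2 i) + formal (tneg F (Z i)) \<in> nullset F"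
      using weak X1(1) X2(1) neg unfolding weak_tract_matroid_def by blast
    have [simp]: "formal (V i) = {#the (V i)#}" "formal (tneg F (V i)) = {#eps \<otimes> the (V i)#}"
      if "i \<in> supp V" for V and i :: 'e
      using that by (auto simp: supp_def formal_def tneg_def tmult_def)
    have [simp]: "formal (V i) = {#}" if "i \<notin> supp V" for V and i :: 'e
      using that by (auto simp: supp_def formal_def)
    \<comment> \<open>An element of \<open>supp Z\<close> outside both circuits would leave a
      one-term null sum. The inclusion then forces \<open>supp Z = supp X\<close> by
      \<open>uniq\<close>, so \<open>Z\<close> and \<open>X\<close> are proportional.\<close>
    have "supp Z \<subseteq> S\<^sub>1 \<union> S\<^sub>2 - {h}"
    proof
      fix i assume i: "i \<in> supp Z"
      then have cl: "eps \<otimes> the (Z i) \<in> carrier F" and "i \<in> E"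
        using the_closed[OF C_vecs[OF Z(1)]] supp_subset[OF C_vecs[OF Z(1)]] by auto
      have "i \<in> S\<^sub>1 \<union> S\<^sub>2"
      proof (rule ccontr)
        assume "i \<notin> S\<^sub>1 \<union> S\<^sub>2"
        then show False
          using null[OF \<open>i \<in> E\<close>] null_single[OF cl] i X1(2) X2(2) by simp
      qed
      then show "i \<in> S\<^sub>1 \<union> S\<^sub>2 - {h}"
        using i Z(2) unfolding supp_def by auto
    qed
    then have ZX: "supp Z = supp X"
      using uniq[OF C_circuit[OF Z(1)]] by blast
    obtain \<alpha> where \<alpha>: "\<alpha> \<in> carrier F" "X = scale F \<alpha> Z"
      using signature_unique[OF signature_C XY(1) Z(1)] ZX by auto
    have "{e, f, g} \<subseteq> E"
      using mem supp_subset[OF C_vecs[OF XY(1)]] by blast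
    then have efg: "e \<in> E" "f \<in> E" "g \<in> E" by auto
    have memZ: "e \<in> supp Z" "f \<in> supp Z" "g \<in> supp Z"
      using mem ZX by auto
    have [simp]: "the (Z e) \<in> carrier F" "the (Z f) \<in> carrier F" "the (Z g) \<in> carrier F"
      "the (X\<^sub>1 e) \<in> carrier F" "the (X\<^sub>1 g) \<in> carrier F"
      "the (X\<^sub>2 f) \<in> carrier F" "the (X\<^sub>2 g) \<in> carrier F"
      using the_closed[OF C_vecs] Z(1) X1 X2 mem memZ by auto
    have [simp]: "\<sigma> (the (Y e)) \<in> carrier F" "\<sigma> (the (Y f)) \<in> carrier F"
      "\<sigma> (the (Y g)) \<in> carrier F"
      using the_closed[OF D_vecs[OF XY(2)]] mem by auto
    \<comment> \<open>Since \<open>e\<close> lies only in \<open>S\<^sub>1\<close> and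
      \<open>f\<close> only in \<open>S\<^sub>2\<close>, elimination gives two-term sums at both; a
      genuine three-term sum remains at \<open>g\<close>.\<close>
    have Ze: "the (Z e) = the (X\<^sub>1 e)"
      using null[OF efg(1)] mem(1,2) memZ(1) X1(2) X2(2)
        null_pair[of "the (X\<^sub>1 e)" "eps \<otimes> the (Z e)"]
      by (simp add: eps_eps_mult add_mset_commute)
    have Zf: "the (Z f) = the (X\<^sub>2 f)"
      using null[OF efg(2)] mem(3,4) memZ(2) X1(2) X2(2)
        null_pair[of "the (X\<^sub>2 f)" "eps \<otimes> the (Z f)"]
      by (simp add: eps_eps_mult add_mset_commute)
    have Zg: "{#the (X\<^sub>1 g), the (X\<^sub>2 g), eps \<otimes> the (Z g)#} \<in> nullset F"
      using null[OF efg(3)] mem(5,6) memZ(3) X1(2) X2(2)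
      by (simp add: add_mset_commute)
    have "orth F \<sigma> E X\<^sub>1 Y" "orth F \<sigma> E X\<^sub>2 Y"
      using perp X1 X2 S1 S2 ne by auto
    then have "pairing X\<^sub>1 Y e = eps \<otimes> pairing X\<^sub>1 Y g" "pairing X\<^sub>2 Y f = eps \<otimes> pairing X\<^sub>2 Y g"
      using orth_pair[OF finite_ground C_vecs[OF X1(1)] D_vecs[OF XY(2)]] S1 X1(2) ne(2)
        orth_pair[OF finite_ground C_vecs[OF X2(1)] D_vecs[OF XY(2)]] S2 X2(2) ne(3) by auto
    \<comment> \<open>The pairings at \<open>e\<close> and \<open>f\<close> become negatives of
      pairings of \<open>X\<^sub>1\<close> and \<open>X\<^sub>2\<close> at \<open>g\<close>. What is
      left is the elimination relation at \<open>g\<close>, multiplied by \<open>eps\<close> and the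
      conjugate of \<open>Y g\<close>.\<close>
    then have "{#pairing Z Y e, pairing Z Y f, pairing Z Y g#} \<in> nullset F"
      using null_triple_neg[of "the (X\<^sub>1 g)" "the (X\<^sub>2 g)" "the (Z g)" "\<sigma> (the (Y g))"] Zg
      unfolding pairing_def Ze Zf by simp
    from T3[OF \<alpha>(1) this]
    have "{#pairing X Y e, pairing X Y f, pairing X Y g#} \<in> nullset F"
      using \<alpha> memZ unfolding pairing_def by (simp add: the_scale m_assoc)
    then show ?thesis
      using orth_triple[OF finite_ground C_vecs[OF XY(1)] D_vecs[OF XY(2)] int ne] by blast
  qed (use perp XY(1) in blast)
qed

end

theorem theorem3p23:
  fixes F :: "'g tract" and \<sigma> :: "'g \<Rightarrow> 'g" and M :: "'e set_system"
    and C D :: "('e \<Rightarrow> 'g option) set"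
  assumes "tract F"
    and "tract_involution F \<sigma>"
    and "matroid M"
    and "tract_signature F M C"
    and "tract_signature F (dual M) D"
  shows "(weak_tract_matroid F (ground M) C \<and> has_underlying_matroid C M \<and>
            D = tract_cocircuits F \<sigma> (ground M) C)
         \<longleftrightarrow>
         (\<forall>X\<in>C. \<forall>Y\<in>D. card (supp X \<inter> supp Y) \<le> 3 \<longrightarrow> orth F \<sigma> (ground M) X Y)"
proof -
  interpret dual_signatures F \<sigma> M C D
    using assms
    by (simp add: dual_signatures_def dual_signatures_axioms_def
        involutive_tract_def involutive_tract_axioms_def)
  show ?thesis
  proof
    assume "weak_tract_matroid F (ground M) C \<and> has_underlying_matroid C M \<and>
      D = tract_cocircuits F \<sigma> (ground M) C"
    then show "\<forall>X\<in>C. \<forall>Y\<in>D. card (supp X \<inter> supp Y) \<le> 3 \<longrightarrow> orth F \<sigma> (ground M) X Y"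
      using orth_if_weak_tract_matroid by blast
  next
    assume "\<forall>X\<in>C. \<forall>Y\<in>D. card (supp X \<inter> supp Y) \<le> 3 \<longrightarrow> orth F \<sigma> (ground M) X Y"
    then have orth: "orth F \<sigma> (ground M) X Y"
      if "X \<in> C" "Y \<in> D" "card (supp X \<inter> supp Y) \<le> 3" for X Y
      using that by blast
    show "weak_tract_matroid F (ground M) C \<and> has_underlying_matroid C M \<and>
      D = tract_cocircuits F \<sigma> (ground M) C"
      using weak_tract_matroid_if_orth[OF orth] signature_supp[OF assms(4)]
        cocircuits_eq_if_orth[OF orth]
      unfolding has_underlying_matroid_def by blast
  qed
qed

end
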